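(* Let $G$ be a Kleinian group and let $P\subset\mathbb{H}^3$ be a fundamental polyhedron for $G$. Then every elliptic element of $G$ is either a generator, a relator, a finite power of a relator, or an element conjugate in $G$ to one of these.
   Context: A Kleinian group is a discrete group of orientation-preserving isometries of $\mathbb{H}^3$. A fundamental polyhedron $P$ for $G$ is a convex polyhedron in $\mathbb{H}^3$ with the following properties. (i) Its faces are arranged in pairs $(\sigma,\sigma')$ of distinct faces; to each pair corresponds an element $g\in G$ (a face identification, or face pairing transformation) with $g(\sigma)=\sigma'$ and $g(P)\cap P=\sigma'$. (ii) If a face pairing transformation is elliptic, there is an edge of $P$ contained in its rotation axis. (iii) To each edge $e$ corresponds an edge relation: start at $e$ regarded as an edge of one of its two faces, apply the face identification of that face to get an edge $e_2$, regard $e_2$ as an edge of its other face, apply the face identification of that face, and so on until one returns to $e$. The resulting product $g_1g_2\cdots g_n=g_e$ in $G$ is either an elliptic of finite order whose rotation axis contains $e$, or the identity. (iv) The translates $h(P)$, $h\in G$, fill $\mathbb{H}^3$ without overlap of interiors. (v) The face pairing transformations generate $G$ and the edge relations generate the relations of $G$. "Generator" means a face pairing transformation of $P$ or its inverse. "Relator" means the element $g_e\in G$ given by the product $g_1g_2\cdots g_n$ in the edge relation of an edge $e$ of $P$ (so a relator may be a nontrivial elliptic element). *)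

theory Defs
  imports "HOL-Analysis.Analysis" "HOL-Algebra.Generated_Groups"
begin

section \<open>Hyperbolic 3-space and its isometries\<close>

text \<open>
  We use the projective (Klein) model, in which hyperbolic lines and planes are the nonempty
  intersections of Euclidean lines and planes with the open unit ball. Hence hyperbolic convexity
  is Euclidean convexity, and hyperbolic half-spaces are traces of Euclidean half-spaces.
\<close>

definition H3 :: "(real^3) set" where
  "H3 = ball 0 1"

definition hdist :: "real^3 \<Rightarrow> real^3 \<Rightarrow> real" where
  "hdist x y = arcosh ((1 - x \<bullet> y) / (sqrt (1 - x \<bullet> x) * sqrt (1 - y \<bullet> y)))"

text \<open>
  Self-maps of \<^const>\<open>H3\<close> are represented by functions that are the identity outside
  \<^const>\<open>H3\<close> (this is part of \<^term>\<open>f permutes H3\<close>), so that equal maps are equal functions and the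
  group operation is plain composition.
\<close>

definition isom_H3 :: "(real^3 \<Rightarrow> real^3) monoid" where
  "isom_H3 =
     \<lparr>carrier = {f. f permutes H3 \<and>
                    (\<forall>x\<in>H3. \<forall>y\<in>H3. hdist (f x) (f y) = hdist x y) \<and>
                    (\<forall>x\<in>H3. \<exists>f'. (f has_derivative f') (at x) \<and> det (matrix f') > 0)},
      mult = (\<circ>),
      one = id\<rparr>"

lemma isom_H3_simps:
  "carrier isom_H3 = {f. f permutes H3 \<and>
     (\<forall>x\<in>H3. \<forall>y\<in>H3. hdist (f x) (f y) = hdist x y) \<and>
     (\<forall>x\<in>H3. \<exists>f'. (f has_derivative f') (at x) \<and> det (matrix f') > 0)}"
  "f \<otimes>\<^bsub>isom_H3\<^esub> g = f \<circ> g"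
  "\<one>\<^bsub>isom_H3\<^esub> = id"
  by (simp_all add: isom_H3_def)

lemma isom_H3_inverse:
  assumes "f \<in> carrier isom_H3"
  shows "inv_into UNIV f \<in> carrier isom_H3"
proof -
  let ?g = "inv_into UNIV f"
  have p: "f permutes H3"
    and d: "\<And>x y. x \<in> H3 \<Longrightarrow> y \<in> H3 \<Longrightarrow> hdist (f x) (f y) = hdist x y"
    and D: "\<And>x. x \<in> H3 \<Longrightarrow> \<exists>f'. (f has_derivative f') (at x) \<and> det (matrix f') > 0"
    using assms by (auto simp: isom_H3_simps)
  have q: "?g permutes H3" using p by (rule permutes_inv)
  have gH: "?g x \<in> H3" if "x \<in> H3" for x using q that by (simp add: permutes_in_image)
  have fg: "f (?g x) = x" for x using permutes_inverses(1)[OF p] .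
  have gf: "?g (f x) = x" for x using permutes_inverses(2)[OF p] .
  have "hdist (?g x) (?g y) = hdist x y" if "x \<in> H3" "y \<in> H3" for x y
    using d[OF gH[OF that(1)] gH[OF that(2)]] by (simp add: fg)
  moreover have "\<exists>g'. (?g has_derivative g') (at x) \<and> det (matrix g') > 0" if x: "x \<in> H3" for x
  proof -
    obtain f' where f': "(f has_derivative f') (at (?g x))" "det (matrix f') > 0"
      using D[OF gH[OF x]] by blast
    have lin: "linear f'" using f'(1) by (simp add: has_derivative_linear)
    have "invertible (matrix f')" using f'(2) by (simp add: invertible_det_nz)
    then obtain B where B: "matrix f' ** B = mat 1" unfolding invertible_def by blast
    have comp: "f' \<circ> (*v) B = id"
    proof
      fix v
      have "f' (B *v v) = (matrix f' ** B) *v v"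
        using lin by (metis matrix_vector_mul matrix_vector_mul_assoc)
      then show "(f' \<circ> (*v) B) v = id v" by (simp add: B)
    qed
    have "continuous_on H3 f"
      by (meson D continuous_at_imp_continuous_on has_derivative_continuous)
    then have "(?g has_derivative (*v) B) (at (f (?g x)))"
      using gf f'(1) comp gH[OF x]
      by (intro has_derivative_inverse_strong[of H3 "?g x" f]) (auto simp: H3_def)
    moreover have "det (matrix f') * det B = 1" using B by (metis det_I det_mul)
    then have "det B > 0" using f'(2) by (metis zero_less_mult_pos zero_less_one)
    ultimately show ?thesis by (metis fg matrix_of_matrix_vector_mul)
  qed
  ultimately show ?thesis using q by (simp add: isom_H3_simps)
qed

lemma group_isom_H3: "group isom_H3"
proof (rule groupI)
  fix f g assume f: "f \<in> carrier isom_H3" and g: "g \<in> carrier isom_H3"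
  have gp: "g permutes H3" using g by (simp add: isom_H3_simps)
  have gH: "g x \<in> H3" if "x \<in> H3" for x using gp that by (simp add: permutes_in_image)
  have "\<exists>h'. (f \<circ> g has_derivative h') (at x) \<and> det (matrix h') > 0" if x: "x \<in> H3" for x
  proof -
    obtain g' where g': "(g has_derivative g') (at x)" "det (matrix g') > 0"
      using g x by (auto simp: isom_H3_simps)
    obtain f' where f': "(f has_derivative f') (at (g x))" "det (matrix f') > 0"
      using f gH[OF x] by (auto simp: isom_H3_simps)
    have "(f \<circ> g has_derivative f' \<circ> g') (at x)" using g' f' by (intro diff_chain_at)
    moreover have "matrix (f' \<circ> g') = matrix f' ** matrix g'"
      using g'(1) f'(1) by (intro matrix_compose) (simp_all add: has_derivative_linear)
    ultimately show ?thesis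
      using f'(2) g'(2) by (metis det_mul mult_pos_pos)
  qed
  then show "f \<otimes>\<^bsub>isom_H3\<^esub> g \<in> carrier isom_H3"
    using f g gH by (auto simp: isom_H3_simps intro: permutes_compose)
next
  show "\<one>\<^bsub>isom_H3\<^esub> \<in> carrier isom_H3"
    by (auto simp: isom_H3_simps permutes_id matrix_id_mat_1 id_def[symmetric]
        intro!: exI[of _ id] has_derivative_id)
next
  fix f assume f: "f \<in> carrier isom_H3"
  then have "f permutes H3" by (simp add: isom_H3_simps)
  then show "\<exists>g\<in>carrier isom_H3. g \<otimes>\<^bsub>isom_H3\<^esub> f = \<one>\<^bsub>isom_H3\<^esub>"
    using isom_H3_inverse[OF f] permutes_inv_o(2) by (auto simp: isom_H3_simps)
qed (auto simp: isom_H3_simps)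

text \<open>
  Topological discreteness refers to the function space topology, which is that of pointwise
  convergence; on isometries it agrees with the compact-open topology.
\<close>

definition kleinian_group :: "(real^3 \<Rightarrow> real^3) set \<Rightarrow> bool" where
  "kleinian_group G \<longleftrightarrow> subgroup G isom_H3 \<and> discrete G"

definition elliptic :: "(real^3 \<Rightarrow> real^3) \<Rightarrow> bool" where
  "elliptic f \<longleftrightarrow> f \<in> carrier isom_H3 \<and> f \<noteq> id \<and> (\<exists>x\<in>H3. f x = x)"

definition rotation_axis :: "(real^3 \<Rightarrow> real^3) \<Rightarrow> (real^3) set" where
  "rotation_axis f = {x \<in> H3. f x = x}"


section \<open>Convex polyhedra\<close>

definition convex_polyhedron :: "(real^3) set \<Rightarrow> bool" where
  "convex_polyhedron P \<longleftrightarrow>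
     interior P \<noteq> {} \<and>
     (\<exists>\<H>. P = H3 \<inter> \<Inter>\<H> \<and>
          (\<forall>h\<in>\<H>. \<exists>a b. a \<noteq> 0 \<and> h = {x. a \<bullet> x \<le> b}) \<and>
          locally_finite_in (top_of_set H3) ((\<lambda>h. H3 \<inter> frontier h) ` \<H>))"

text \<open>
  A convex polyhedron together with its faces and edges. As usual for fundamental polyhedra, a
  planar piece of the boundary may be subdivided into several faces and a side of a face into
  several edges (dihedral angles and angles of faces equal to \<open>\<pi>\<close> are permitted), which is why
  faces and edges are given as data; the coarsest choice consists of the two- and one-dimensional
  faces of \<open>P\<close> as a convex set. Faces and edges may be unbounded in \<^const>\<open>H3\<close>, and there may be
  infinitely many of them.
\<close>

locale polyhedron =
  fixes P :: "(real^3) set"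
    and faces :: "(real^3) set set"
    and edges :: "(real^3) set set"
  assumes P_polyhedron: "convex_polyhedron P"
    and face_shape: "F \<in> faces \<Longrightarrow> convex F \<and> closedin (top_of_set H3) F \<and> aff_dim F = 2"
    and faces_locally_finite: "locally_finite_in (top_of_set H3) faces"
    and faces_cover: "\<Union>faces = H3 \<inter> frontier P"
    and faces_disjoint: "pairwise (\<lambda>F F'. disjnt (rel_interior F) (rel_interior F')) faces"
    and edge_shape: "E \<in> edges \<Longrightarrow> convex E \<and> closedin (top_of_set H3) E \<and> aff_dim E = 1"
    and edges_locally_finite: "locally_finite_in (top_of_set H3) edges"
    and edges_disjoint: "pairwise (\<lambda>E E'. disjnt (rel_interior E) (rel_interior E')) edges"
    and face_boundary: "F \<in> faces \<Longrightarrow> H3 \<inter> rel_frontier F = \<Union>{E \<in> edges. E \<subseteq> F}"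
    and edge_two_faces: "E \<in> edges \<Longrightarrow> card {F \<in> faces. E \<subseteq> F} = 2"


section \<open>Face pairings, edge cycles and relators\<close>

text \<open>
  The face identifications are given by a function \<open>gen\<close> on faces: \<open>gen F\<close> carries \<open>F\<close> to its
  partner \<open>gen F ` F\<close>. For the two faces of a pair the identifications are inverse to each other,
  so the values of \<open>gen\<close> are exactly the face pairing transformations and their inverses.
\<close>

definition other_face :: "(real^3) set set \<Rightarrow> (real^3) set \<Rightarrow> (real^3) set \<Rightarrow> (real^3) set" where
  "other_face faces E F = (THE F'. F' \<in> faces \<and> E \<subseteq> F' \<and> F' \<noteq> F)"

definition edge_step ::
  "(real^3) set set \<Rightarrow> ((real^3) set \<Rightarrow> real^3 \<Rightarrow> real^3) \<Rightarrow>
   (real^3) set \<times> (real^3) set \<Rightarrow> (real^3) set \<times> (real^3) set" where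
  "edge_step faces gen = (\<lambda>(E, F). (gen F ` E, other_face faces (gen F ` E) (gen F ` F)))"

definition edge_returns ::
  "(real^3) set set \<Rightarrow> ((real^3) set \<Rightarrow> real^3 \<Rightarrow> real^3) \<Rightarrow>
   (real^3) set \<Rightarrow> (real^3) set \<Rightarrow> nat \<Rightarrow> bool" where
  "edge_returns faces gen E F n \<longleftrightarrow> n > 0 \<and> fst ((edge_step faces gen ^^ n) (E, F)) = E"

text \<open>The faces whose identifications are applied successively until the edge \<open>E\<close> recurs.\<close>

definition edge_cycle ::
  "(real^3) set set \<Rightarrow> ((real^3) set \<Rightarrow> real^3 \<Rightarrow> real^3) \<Rightarrow>
   (real^3) set \<Rightarrow> (real^3) set \<Rightarrow> (real^3) set list" where
  "edge_cycle faces gen E F =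
     map (\<lambda>i. snd ((edge_step faces gen ^^ i) (E, F))) [0..<(LEAST n. edge_returns faces gen E F n)]"

text \<open>
  Words are lists of faces, a face \<open>F\<close> standing for the letter \<open>gen F\<close>. The transformation listed
  first is applied first, as is needed for the product along an edge cycle to carry the edge to
  itself.
\<close>

definition word_map ::
  "((real^3) set \<Rightarrow> real^3 \<Rightarrow> real^3) \<Rightarrow> (real^3) set list \<Rightarrow> real^3 \<Rightarrow> real^3" where
  "word_map gen w = fold (\<lambda>F f. gen F \<circ> f) w id"

definition edge_relator ::
  "(real^3) set set \<Rightarrow> ((real^3) set \<Rightarrow> real^3 \<Rightarrow> real^3) \<Rightarrow>
   (real^3) set \<Rightarrow> (real^3) set \<Rightarrow> real^3 \<Rightarrow> real^3" where
  "edge_relator faces gen E F = word_map gen (edge_cycle faces gen E F)"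

definition generators ::
  "(real^3) set set \<Rightarrow> ((real^3) set \<Rightarrow> real^3 \<Rightarrow> real^3) \<Rightarrow> (real^3 \<Rightarrow> real^3) set" where
  "generators faces gen = gen ` faces"

definition relators ::
  "(real^3) set set \<Rightarrow> (real^3) set set \<Rightarrow> ((real^3) set \<Rightarrow> real^3 \<Rightarrow> real^3) \<Rightarrow>
   (real^3 \<Rightarrow> real^3) set" where
  "relators faces edges gen =
     {edge_relator faces gen E F | E F. E \<in> edges \<and> F \<in> faces \<and> E \<subseteq> F}"

text \<open>
  One elementary transformation of words: deletion of a letter followed by its inverse letter, or
  deletion of an edge relation. If \<open>edge_relator\<close> is elliptic of order \<open>m\<close>, the relation that holds
  in the group is its \<open>m\<close>-th power.
\<close>

inductive word_step ::
  "(real^3) set set \<Rightarrow> (real^3) set set \<Rightarrow> ((real^3) set \<Rightarrow> real^3 \<Rightarrow> real^3) \<Rightarrow>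
   (real^3) set list \<Rightarrow> (real^3) set list \<Rightarrow> bool"
  for faces edges gen where
  cancel: "F \<in> faces \<Longrightarrow> word_step faces edges gen (u @ [F, gen F ` F] @ v) (u @ v)"
| relation: "E \<in> edges \<Longrightarrow> F \<in> faces \<Longrightarrow> E \<subseteq> F \<Longrightarrow> edge_relator faces gen E F ^^ m = id \<Longrightarrow>
    word_step faces edges gen
      (u @ concat (replicate m (edge_cycle faces gen E F)) @ v) (u @ v)"


section \<open>Fundamental polyhedra\<close>

locale fundamental_polyhedron = polyhedron P faces edges
  for G :: "(real^3 \<Rightarrow> real^3) set"
    and P :: "(real^3) set"
    and faces :: "(real^3) set set"
    and edges :: "(real^3) set set"
    and gen :: "(real^3) set \<Rightarrow> real^3 \<Rightarrow> real^3" +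
  assumes pairing:
    "F \<in> faces \<Longrightarrow> gen F \<in> G \<and> gen F ` F \<in> faces \<and> gen F ` F \<noteq> F"
    and pairing_inverse:
    "F \<in> faces \<Longrightarrow> gen (gen F ` F) = inv\<^bsub>isom_H3\<^esub> (gen F)"
    and pairing_meet:
    "F \<in> faces \<Longrightarrow> gen F ` P \<inter> P = gen F ` F"
    and elliptic_pairing:
    "F \<in> faces \<Longrightarrow> elliptic (gen F) \<Longrightarrow> \<exists>E\<in>edges. E \<subseteq> rotation_axis (gen F)"
    and pairing_edges:
    "E \<in> edges \<Longrightarrow> F \<in> faces \<Longrightarrow> E \<subseteq> F \<Longrightarrow> gen F ` E \<in> edges"
    and edge_cycle_closes:
    "E \<in> edges \<Longrightarrow> F \<in> faces \<Longrightarrow> E \<subseteq> F \<Longrightarrow> \<exists>n. edge_returns faces gen E F n"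
    and edge_cycle_relator:
    "E \<in> edges \<Longrightarrow> F \<in> faces \<Longrightarrow> E \<subseteq> F \<Longrightarrow>
       edge_relator faces gen E F = id \<or>
       elliptic (edge_relator faces gen E F) \<and>
       (\<exists>m>0. edge_relator faces gen E F ^^ m = id) \<and>
       E \<subseteq> rotation_axis (edge_relator faces gen E F)"
    and translates_cover: "(\<Union>h\<in>G. h ` P) = H3"
    and translates_disjoint:
    "h \<in> G \<Longrightarrow> k \<in> G \<Longrightarrow> h \<noteq> k \<Longrightarrow> interior (h ` P) \<inter> interior (k ` P) = {}"
    and pairings_generate: "generate isom_H3 (generators faces gen) = G"
    and relations_generate:
    "w \<in> lists faces \<Longrightarrow> word_map gen w = id \<Longrightarrow> equivclp (word_step faces edges gen) w []"

end

theory Submission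
  imports Defs
begin

text \<open>
  An elliptic \<open>g \<in> G\<close> fixes a whole geodesic pointwise, its axis. All the group elements are
  products of the countably many face pairings, and there are countably many edges with at most two
  endpoints each, so some point of the axis is a translate of no endpoint of an edge
  (\<open>generic_fixed_point\<close>). After conjugation in \<open>G\<close> this point \<open>x\<close> lies in \<open>P\<close>, and then
  \<open>g\<close> is determined by the arrangement of the tiles near \<open>x\<close>
  (\<open>stabilizer_of_generic_point\<close>): if certain tiles together contain a neighbourhood of \<open>x\<close>,
  then the tile that corresponds to \<open>g\<close> is one of them (\<open>tile_in_neighbouring_tiles\<close>).

  If \<open>x\<close> is interior to \<open>P\<close>, then \<open>g\<close> would be the identity. If \<open>x\<close> is relatively interior
  to a face, the only tiles near \<open>x\<close> are \<open>P\<close> and the tile across this face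
  (\<open>face_neighbourhood\<close>), so \<open>g\<close> is a generator. Otherwise \<open>x\<close> is relatively interior
  to an edge. The tiles around that edge are obtained by following its edge cycle until the product
  of the face pairings is the identity (\<open>edge_neighbourhood\<close>), so \<open>g\<close> is the product along an
  initial part of the iterated cycle. As \<open>g\<close> fixes \<open>x\<close>, this part returns to the edge, so it
  consists of complete cycles and \<open>g\<close> is a power of the relator.

  The existence of the axis (\<open>isometry_fixes_line\<close>) uses the hyperboloid: an isometry is induced by
  a linear Lorentz transformation, and the derivative at a fixed point is an orientation-preserving
  isometry of a three-dimensional inner product, which has eigenvalue one.
\<close>

section \<open>Isometries and the Lorentz form\<close>

definition lorentz :: "real \<times> (real^3) \<Rightarrow> real \<times> (real^3) \<Rightarrow> real" where
  "lorentz v w = snd v \<bullet> snd w - fst v * fst w"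

lemma lorentz_simps:
  "lorentz (u + v) w = lorentz u w + lorentz v w"
  "lorentz w (u + v) = lorentz w u + lorentz w v"
  "lorentz (c *\<^sub>R v) w = c * lorentz v w"
  "lorentz w (c *\<^sub>R v) = c * lorentz w v"
  "lorentz (u - v) w = lorentz u w - lorentz v w"
  "lorentz w (u - v) = lorentz w u - lorentz w v"
  by (simp_all add: lorentz_def inner_simps algebra_simps)

lemma bilinear_lorentz: "bilinear lorentz"
  unfolding bilinear_def by (intro conjI allI linearI) (simp_all add: lorentz_simps)

lemma lorentz_nondegenerate:
  assumes "\<And>w. lorentz v w = 0"
  shows "v = 0"
  using assms[of "(fst v, 0)"] assms[of "(0, snd v)"]
  by (simp add: lorentz_def prod_eq_iff)

text \<open>
  The extension is fixed by its values on a basis inside \<open>S\<close>. It preserves the form, hence is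
  injective and onto, so the images of the basis span; an element of \<open>S\<close> and its image under
  \<open>\<phi>\<close> then have the same products with a spanning set, and nondegeneracy identifies the
  extension with \<open>\<phi>\<close> on all of \<open>S\<close>.
\<close>

lemma form_preserving_extends_linearly:
  fixes B :: "'a::euclidean_space \<Rightarrow> 'a \<Rightarrow> real"
  assumes B: "bilinear B"
    and nondeg: "\<And>v. (\<And>w. B v w = 0) \<Longrightarrow> v = 0"
    and S: "span S = UNIV"
    and pres: "\<And>s t. s \<in> S \<Longrightarrow> t \<in> S \<Longrightarrow> B (\<phi> s) (\<phi> t) = B s t"
  obtains L where "linear L" "\<And>s. s \<in> S \<Longrightarrow> L s = \<phi> s" "\<And>v w. B (L v) (L w) = B v w"
proof -
  obtain b where b: "b \<subseteq> S" "independent b" "S \<subseteq> span b"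
    using maximal_independent_subset by blast
  have spb: "span b = UNIV" using S b(3) by (metis span_mono span_span top.extremum_uniqueI)
  obtain L where L: "linear L" "\<And>x. x \<in> b \<Longrightarrow> L x = \<phi> x"
    using linear_independent_extend[OF b(2)] by metis
  have linl: "linear (\<lambda>v. B v w)" and linr: "linear (\<lambda>v. B w v)" for w
    using B by (auto simp: bilinear_def)
  have 1: "B (L v) (L y) = B v y" if "y \<in> b" for v y
  proof -
    have "linear (\<lambda>v. B (L v) (L y))"
      using linear_compose[OF L(1) linl[of "L y"]] by (simp add: o_def)
    then show ?thesis
    proof (rule linear_eq_on[OF _ linl])
      show "v \<in> span b" using spb by simp
      show "B (L u) (L y) = B u y" if "u \<in> b" for u
        using that \<open>y \<in> b\<close> b(1) L(2) pres[of u y] by (simp add: subset_iff)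
    qed
  qed
  have 2: "B (L v) (L w) = B v w" for v w
  proof -
    have "linear (\<lambda>w. B (L v) (L w))"
      using linear_compose[OF L(1) linr[of "L v"]] by (simp add: o_def)
    then show ?thesis
      by (rule linear_eq_on[OF _ linr _ 1, where B = b]) (simp_all add: spb)
  qed
  have "inj L"
  proof (rule linear_injective_0[OF L(1), THEN iffD2], intro allI impI)
    fix v assume "L v = 0"
    then have "B v w = 0" for w using 2[of v w] linear_0[OF linl] by metis
    then show "v = 0" by (rule nondeg)
  qed
  then have "surj L" using L(1) linear_injective_imp_surjective by blast
  then have spL: "span (L ` b) = UNIV"
    by (simp add: linear_span_image[OF L(1)] spb)
  have "L s = \<phi> s" if s: "s \<in> S" for s
  proof -
    have *: "B (L s - \<phi> s) y = 0" if y: "y \<in> L ` b" for y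
    proof -
      obtain x where x: "x \<in> b" "y = L x" using y by blast
      have "B (L s) y = B s x" using x 1 by simp
      moreover have "B (\<phi> s) y = B s x" using x L(2) pres s b(1) by auto
      ultimately show ?thesis using linear_diff[OF linl] by simp
    qed
    have "B (L s - \<phi> s) w = 0" for w
      by (rule linear_eq_on[OF linr module_hom_zero _ *, where B = "L ` b"]) (simp_all add: spL)
    then show ?thesis using nondeg by force
  qed
  with L(1) 2 that show thesis by blast
qed

text \<open>
  The reversed Cauchy-Schwarz inequality for timelike vectors. It places the argument of
  \<^const>\<open>arcosh\<close> in \<^const>\<open>hdist\<close> in the range where \<^const>\<open>arcosh\<close> is injective, so that
  the distance determines the Lorentz product.
\<close>

lemma one_le_cosh_dist:
  fixes x y :: "real^3"
  assumes "x \<in> H3" "y \<in> H3"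
  shows "1 \<le> (1 - x \<bullet> y) / (sqrt (1 - x \<bullet> x) * sqrt (1 - y \<bullet> y))"
proof -
  define a where "a = norm x"
  define b where "b = norm y"
  have ab: "0 \<le> a" "a < 1" "0 \<le> b" "b < 1" using assms by (auto simp: H3_def a_def b_def)
  have xx: "x \<bullet> x = a\<^sup>2" "y \<bullet> y = b\<^sup>2" by (simp_all add: a_def b_def power2_norm_eq_inner)
  have p: "0 < 1 - a\<^sup>2" "0 < 1 - b\<^sup>2" using ab by (simp_all add: abs_square_less_1)
  have "(1 - a\<^sup>2) * (1 - b\<^sup>2) \<le> (1 - a * b)\<^sup>2"
    using zero_le_power2[of "a - b"] by (simp add: power2_eq_square algebra_simps)
  moreover have "0 \<le> 1 - a * b" using ab by (simp add: mult_le_one)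
  ultimately have "sqrt ((1 - a\<^sup>2) * (1 - b\<^sup>2)) \<le> 1 - a * b"
    by (metis real_le_lsqrt)
  also have "\<dots> \<le> 1 - x \<bullet> y" using norm_cauchy_schwarz[of x y] by (simp add: a_def b_def)
  finally show ?thesis using p by (simp add: xx real_sqrt_mult le_divide_eq)
qed

text \<open>
  The Klein ball is the central projection of the hyperboloid of unit timelike vectors; this is the
  inverse of that projection.
\<close>

definition hyperboloid_lift :: "real^3 \<Rightarrow> real \<times> (real^3)" where
  "hyperboloid_lift x = (1 / sqrt (1 - x \<bullet> x)) *\<^sub>R (1, x)"

lemma H3_iff: "x \<in> H3 \<longleftrightarrow> x \<bullet> x < 1"
  by (simp add: H3_def norm_lt_square dist_norm norm_eq_sqrt_inner)

lemma lorentz_lift: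
  "lorentz (hyperboloid_lift x) (hyperboloid_lift y) =
   - ((1 - x \<bullet> y) / (sqrt (1 - x \<bullet> x) * sqrt (1 - y \<bullet> y)))"
  by (simp add: hyperboloid_lift_def lorentz_def diff_divide_distrib)

lemma span_lift: "span (hyperboloid_lift ` H3) = UNIV"
proof -
  let ?T = "span (hyperboloid_lift ` H3)"
  have 1: "(1, x) \<in> ?T" if "x \<in> H3" for x
  proof -
    have "sqrt (1 - x \<bullet> x) *\<^sub>R hyperboloid_lift x = (1, x)"
      using that by (simp add: hyperboloid_lift_def H3_iff)
    then show ?thesis using that by (metis imageI span_base span_scale)
  qed
  have 10: "(1, 0) \<in> ?T" using 1[of 0] by (simp add: H3_def)
  have 2: "(0, x) \<in> ?T" for x
  proof -
    define c where "c = 1 / (1 + norm x)"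
    have c: "c > 0" by (simp add: c_def add_pos_nonneg)
    have "c *\<^sub>R x \<in> H3" using norm_ge_zero[of x]
      by (simp add: H3_def c_def divide_simps del: norm_ge_zero)
    then have "(1, c *\<^sub>R x) - (1, 0) \<in> ?T" using 1 10 span_diff by blast
    then have "(1/c) *\<^sub>R ((1, c *\<^sub>R x) - (1, 0)) \<in> ?T" by (rule span_scale)
    then show ?thesis using c by simp
  qed
  have "v \<in> ?T" for v
  proof -
    have "v = fst v *\<^sub>R (1, 0) + (0, snd v)" by (simp add: prod_eq_iff)
    then show ?thesis using 10 2 by (metis span_add span_scale)
  qed
  then show ?thesis by blast
qed

text \<open>
  The distance of two points determines the Lorentz product of their lifts, so \<open>f\<close> induces a
  form-preserving map on the hyperboloid, which spans the whole space.
\<close>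

lemma isometry_lorentz_linear:
  assumes f: "f \<in> carrier isom_H3"
  obtains L where "linear L" "\<And>v w. lorentz (L v) (L w) = lorentz v w"
    "\<And>y. y \<in> H3 \<Longrightarrow> L (hyperboloid_lift y) = hyperboloid_lift (f y)"
proof -
  have perm: "f permutes H3" and
    d: "\<And>x y. x \<in> H3 \<Longrightarrow> y \<in> H3 \<Longrightarrow> hdist (f x) (f y) = hdist x y"
    using f by (auto simp: isom_H3_simps)
  have fH: "f x \<in> H3" if "x \<in> H3" for x using perm that by (simp add: permutes_in_image)
  have inj: "inj_on hyperboloid_lift H3"
    by (rule inj_onI) (auto simp: hyperboloid_lift_def H3_iff)
  define \<phi> where "\<phi> = (\<lambda>v. hyperboloid_lift (f (inv_into H3 hyperboloid_lift v)))"
  have \<phi>: "\<phi> (hyperboloid_lift y) = hyperboloid_lift (f y)" if "y \<in> H3" for y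
    using that inj by (simp add: \<phi>_def)
  have pres: "lorentz (\<phi> s) (\<phi> t) = lorentz s t"
    if st: "s \<in> hyperboloid_lift ` H3" "t \<in> hyperboloid_lift ` H3" for s t
  proof -
    obtain x y where xy: "x \<in> H3" "y \<in> H3" "s = hyperboloid_lift x" "t = hyperboloid_lift y"
      using st by blast
    have "cosh (hdist u v) = - lorentz (hyperboloid_lift u) (hyperboloid_lift v)"
      if "u \<in> H3" "v \<in> H3" for u v
      using that by (simp only: hdist_def lorentz_lift one_le_cosh_dist cosh_arcosh_real minus_minus)
    then have "lorentz (hyperboloid_lift (f x)) (hyperboloid_lift (f y)) =
      lorentz (hyperboloid_lift x) (hyperboloid_lift y)"
      using d[of x y] xy fH by (metis minus_equation_iff)
    then show ?thesis using xy \<phi> by simp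
  qed
  from form_preserving_extends_linearly[where \<phi> = \<phi>, OF bilinear_lorentz lorentz_nondegenerate span_lift pres]
  obtain L where "linear L" "\<And>s. s \<in> hyperboloid_lift ` H3 \<Longrightarrow> L s = \<phi> s"
    "\<And>v w. lorentz (L v) (L w) = lorentz v w" by metis
  then show thesis using that \<phi> by simp
qed


text \<open>
  The reason why every orientation-preserving isometry of a three-dimensional inner product space
  has an axis, for an inner product with an arbitrary Gram matrix \<open>Q\<close>: invariance gives
  \<open>A\<^sup>T Q (A - 1) = (1 - A\<^sup>T) Q\<close>, and in odd dimension the determinants of
  \<open>A - 1\<close> and \<open>1 - A\<close> are opposite, so both vanish.
\<close>

lemma form_preserving_fixes_vector:
  fixes A Q :: "real^3^3"
  assumes "transpose A ** Q ** A = Q" "det Q \<noteq> 0" "det A > 0"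
  obtains v where "v \<noteq> 0" "A *v v = v"
proof -
  have "det A * det Q * det A = det Q" using assms(1) by (metis det_mul det_transpose)
  then have "det A * det A = 1" using assms(2) by simp
  then have dA: "det A = 1" using assms(3)
    by (metis abs_of_pos abs_square_eq_1 power2_eq_square)
  have diffl: "M ** (N - N') = M ** N - M ** N'" and diffr: "(N - N') ** M = N ** M - N' ** M"
    for M N N' :: "real^3^3"
    by (simp_all add: vec_eq_iff matrix_matrix_mult_def sum_subtractf algebra_simps)
  have det_uminus: "det (- M) = - det M" for M :: "real^3^3" by (simp add: det_3)
  have "transpose A ** Q ** (A - mat 1) = (mat 1 - transpose A) ** Q"
    using assms(1) by (simp add: diffl diffr)
  then have "det (transpose A ** Q ** (A - mat 1)) = det ((mat 1 - transpose A) ** Q)" by simp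
  then have "det (A - mat 1) = det (mat 1 - transpose A)"
    using dA assms(2) by (simp add: det_mul)
  also have "mat 1 - transpose A = transpose (- (A - mat 1))"
    by (simp add: vec_eq_iff transpose_def mat_def)
  also have "det \<dots> = - det (A - mat 1)"
    by (simp only: det_transpose det_uminus)
  finally have "det (A - mat 1) = 0" by simp
  then have "\<not> invertible (A - mat 1)" by (simp add: invertible_det_nz)
  then obtain v where "v \<noteq> 0" "(A - mat 1) *v v = 0"
    by (metis invertible_left_inverse matrix_left_invertible_ker)
  then show thesis using that[of v] by (simp add: matrix_vector_mult_diff_rdistrib)
qed

text \<open>
  Let \<open>L\<close> be the Lorentz transformation that induces \<open>f\<close> and \<open>X = (1, x)\<close> the vector that
  represents the fixed point. The tangent space at \<open>x\<close> is identified with the orthogonal complement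
  of \<open>X\<close>, on which the Lorentz form is positive definite and where \<open>L\<close> acts as the derivative
  of \<open>f\<close>. Positivity of its determinant yields a fixed tangent vector \<open>v\<close>. Then \<open>L\<close>
  fixes the plane spanned by \<open>X\<close> and \<open>(0, v)\<close>, which cuts out the line in the Klein ball.
\<close>

lemma isometry_fixes_line:
  assumes f: "f \<in> carrier isom_H3" and x: "x \<in> H3" "f x = x"
  obtains v where "v \<noteq> 0" "\<And>t. x + t *\<^sub>R v \<in> H3 \<Longrightarrow> f (x + t *\<^sub>R v) = x + t *\<^sub>R v"
proof -
  have fH: "f y \<in> H3" if "y \<in> H3" for y
    using f that by (simp add: isom_H3_simps permutes_in_image)
  obtain L where L: "linear L" "\<And>v w. lorentz (L v) (L w) = lorentz v w"
    "\<And>y. y \<in> H3 \<Longrightarrow> L (hyperboloid_lift y) = hyperboloid_lift (f y)"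
    using isometry_lorentz_linear[OF f] by blast
  define X where "X = (1::real, x)"
  define k where "k = 1 - x \<bullet> x"
  have k: "k > 0" using x by (simp add: k_def H3_iff)
  have XX: "lorentz X X = - k" by (simp add: X_def lorentz_def k_def)
  have Ly: "\<exists>c. c \<noteq> 0 \<and> L (1, y) = c *\<^sub>R (1, f y)" if y: "y \<in> H3" for y
  proof -
    have "(1, y) = sqrt (1 - y \<bullet> y) *\<^sub>R hyperboloid_lift y"
      using y by (simp add: hyperboloid_lift_def H3_iff)
    then have "L (1, y) = sqrt (1 - y \<bullet> y) *\<^sub>R hyperboloid_lift (f y)"
      using L(3)[OF y] linear_scale[OF L(1)] by simp
    then show ?thesis using y fH[OF y]
      by (intro exI[of _ "sqrt (1 - y \<bullet> y) / sqrt (1 - f y \<bullet> f y)"])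
        (auto simp: hyperboloid_lift_def H3_iff)
  qed
  have LX: "L X = X"
  proof -
    have "L (hyperboloid_lift x) = hyperboloid_lift x" using L(3) x by simp
    then have "(1 / sqrt k) *\<^sub>R L X = (1 / sqrt k) *\<^sub>R X"
      by (simp only: hyperboloid_lift_def linear_scale[OF L(1)] X_def k_def)
    then show ?thesis using k by simp
  qed
  \<comment> \<open>The derivative of the projective action of \<open>L\<close>, written in the affine chart of the ball.\<close>
  define A where "A = (\<lambda>v. snd (L (0, v)) - fst (L (0, v)) *\<^sub>R x)"
  have "linear (\<lambda>v. L (0, v))"
    using linear_compose[of "\<lambda>v. (0, v)" L] L(1) by (simp add: o_def linear_iff)
  then have linA: "linear A"
    unfolding A_def by (simp add: linear_iff algebra_simps)
  have L0: "L (0, v) = (0, A v) + fst (L (0, v)) *\<^sub>R X" for v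
    by (simp add: A_def X_def prod_eq_iff)
  have bl: "bounded_linear L" using L(1) by (simp add: linear_conv_bounded_linear)
  have fder: "(f has_derivative A) (at x)"
  proof (rule has_derivative_transform_within_open[where s = H3])
    show "open H3" by (simp add: H3_def)
    show "x \<in> H3" by fact
    have 1: "((\<lambda>y. L (1, y)) has_derivative (\<lambda>h. L (0, h))) (at x)"
      by (rule bounded_linear.has_derivative[OF bl]) (auto intro!: derivative_eq_intros)
    have quotient: "((\<lambda>y. inverse (u y) *\<^sub>R w y) has_derivative (\<lambda>h. w' h - u' h *\<^sub>R w x)) (at x)"
      if "(u has_derivative u') (at x)" "(w has_derivative w') (at x)" "u x = 1"
      for u u' and w w' :: "real^3 \<Rightarrow> real^3"
    proof -
      have "((\<lambda>y. inverse (u y)) has_derivative (\<lambda>h. - (inverse (u x) * u' h * inverse (u x)))) (at x)"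
        using Deriv.has_derivative_inverse[OF _ that(1)] that(3) by simp
      from has_derivative_scaleR[OF this that(2)] show ?thesis
        by (simp add: that(3))
    qed
    have e: "L (1, x) = (1, x)" using LX by (simp add: X_def)
    show "((\<lambda>y. inverse (fst (L (1, y))) *\<^sub>R snd (L (1, y))) has_derivative A) (at x)"
      using quotient[OF has_derivative_fst[OF 1] has_derivative_snd[OF 1]]
      by (simp add: e A_def[abs_def])
    show "inverse (fst (L (1, y))) *\<^sub>R snd (L (1, y)) = f y" if "y \<in> H3" for y
      using Ly[OF that] by auto
  qed
  have detA: "det (matrix A) > 0"
  proof -
    obtain f' where f': "(f has_derivative f') (at x)" "det (matrix f') > 0"
      using f x(1) by (auto simp: isom_H3_simps)
    have "f' = A" by (rule has_derivative_unique[OF f'(1) fder])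
    with f'(2) show ?thesis by simp
  qed
  \<comment> \<open>Orthogonal projection to the complement of \<open>X\<close>, which identifies it with the tangent space.\<close>
  define p where "p = (\<lambda>v. (0, v) + ((x \<bullet> v) / k) *\<^sub>R X)"
  have pX: "lorentz (p v) X = 0" for v
    using k by (simp add: p_def lorentz_simps XX) (simp add: lorentz_def X_def inner_commute)
  have Lp: "L (p v) = p (A v)" for v
  proof -
    define a where "a = fst (L (0, v))"
    have La: "L (0, v) = (0, A v) + a *\<^sub>R X" using L0[of v] by (simp only: a_def)
    define c where "c = a + (x \<bullet> v) / k - (x \<bullet> A v) / k"
    have "L (p v) = L (0, v) + ((x \<bullet> v) / k) *\<^sub>R X"
      by (simp add: p_def linear_add[OF L(1)] linear_scale[OF L(1)] LX)
    then have e: "L (p v) = p (A v) + c *\<^sub>R X"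
      by (simp add: p_def La c_def algebra_simps)
    have "lorentz (L (p v)) X = 0" using L(2)[of "p v" X] LX pX by simp
    then have "c * k = 0" by (simp add: e lorentz_simps pX XX)
    then show ?thesis using e k by simp
  qed
  \<comment> \<open>The hyperbolic metric tensor at \<open>x\<close>, up to a factor, relative to the Euclidean one.\<close>
  define Q where "Q = (\<lambda>v. v + ((x \<bullet> v) / k) *\<^sub>R x)"
  have linQ: "linear Q" by (simp add: Q_def linear_iff algebra_simps inner_simps add_divide_distrib)
  have pp: "lorentz (p v) (p w) = Q v \<bullet> w" for v w
  proof -
    have "lorentz (p v) (p w) = lorentz (p v) (0, w)"
      using pX[of v] by (subst (2) p_def) (simp add: lorentz_simps)
    then show ?thesis by (simp add: lorentz_def p_def Q_def X_def inner_simps)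
  qed
  have "transpose (matrix A) ** matrix Q ** matrix A = matrix Q"
  proof (rule matrix_eq[THEN iffD2], intro allI)
    fix v
    have eq: "(transpose (matrix A) ** matrix Q ** matrix A) *v v = Q (A v) v* matrix A"
      by (simp add: matrix_vector_mul_assoc[symmetric] matrix_works linA linQ
          del: matrix_vector_mul_assoc)
    have "((transpose (matrix A) ** matrix Q ** matrix A) *v v) \<bullet> w = (matrix Q *v v) \<bullet> w" for w
    proof -
      have "((transpose (matrix A) ** matrix Q ** matrix A) *v v) \<bullet> w = Q (A v) \<bullet> A w"
        using eq by (simp add: dot_lmul_matrix matrix_works linA)
      also have "\<dots> = Q v \<bullet> w" using L(2)[of "p v" "p w"] by (simp add: Lp pp)
      finally show ?thesis by (simp add: matrix_works linQ)
    qed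
    then show "(transpose (matrix A) ** matrix Q ** matrix A) *v v = matrix Q *v v"
      by (metis vector_eq_rdot)
  qed
  moreover have "det (matrix Q) \<noteq> 0"
  proof -
    have "v = 0" if "matrix Q *v v = 0" for v
    proof -
      have "Q v \<bullet> v = 0" using that by (simp add: matrix_works linQ)
      then have "v \<bullet> v + (x \<bullet> v)\<^sup>2 / k = 0" by (simp add: Q_def inner_simps power2_eq_square)
      moreover have "(x \<bullet> v)\<^sup>2 / k \<ge> 0" using k by simp
      ultimately show ?thesis by (metis add_nonneg_eq_0_iff inner_eq_zero_iff inner_ge_zero)
    qed
    then show ?thesis
      by (metis invertible_det_nz invertible_left_inverse matrix_left_invertible_ker)
  qed
  ultimately obtain v where v: "v \<noteq> 0" "matrix A *v v = v"
    using form_preserving_fixes_vector[of "matrix A" "matrix Q"] detA by blast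
  then have "A v = v" by (simp add: matrix_works linA)
  then have "L (p v) = p v" using Lp by simp
  then have L0v: "L (0, v) = (0, v)"
    by (simp add: p_def linear_add[OF L(1)] linear_scale[OF L(1)] LX)
  have "f (x + t *\<^sub>R v) = x + t *\<^sub>R v" if t: "x + t *\<^sub>R v \<in> H3" for t
  proof -
    have "(1, x + t *\<^sub>R v) = X + t *\<^sub>R (0, v)" by (simp add: X_def)
    then have "L (1, x + t *\<^sub>R v) = (1, x + t *\<^sub>R v)"
      by (simp only: linear_add[OF L(1)] linear_scale[OF L(1)] LX L0v)
    then show ?thesis using Ly[OF t] by auto
  qed
  with v(1) that show thesis by blast
qed

section \<open>Local structure of a convex polyhedron\<close>

lemma locally_finite_isolate:
  assumes lf: "locally_finite_in (top_of_set S) \<A>" and S: "open S" and x: "x \<in> S"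
    and cl: "\<And>A. A \<in> \<A> \<Longrightarrow> closedin (top_of_set S) A"
  obtains U where "open U" "x \<in> U" "U \<subseteq> S" "\<And>A y. A \<in> \<A> \<Longrightarrow> y \<in> A \<Longrightarrow> y \<in> U \<Longrightarrow> x \<in> A"
proof -
  obtain V where V: "openin (top_of_set S) V" "x \<in> V" "finite {A \<in> \<A>. A \<inter> V \<noteq> {}}"
    using lf x by (auto simp: locally_finite_in_def)
  define U where "U = V - \<Union>{A \<in> \<A>. A \<inter> V \<noteq> {} \<and> x \<notin> A}"
  have "closedin (top_of_set S) (\<Union>{A \<in> \<A>. A \<inter> V \<noteq> {} \<and> x \<notin> A})"
    by (rule closedin_Union) (auto intro: cl finite_subset[OF _ V(3)])
  then have "openin (top_of_set S) U" unfolding U_def using V(1) by blast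
  then have "open U" "U \<subseteq> S" using S by (auto simp: openin_open_eq)
  moreover have "x \<in> U" using V(2) by (auto simp: U_def)
  moreover have "x \<in> A" if "A \<in> \<A>" "y \<in> A" "y \<in> U" for A y
    using that by (auto simp: U_def)
  ultimately show thesis using that by blast
qed

text \<open>
  Adding the whole space to the family keeps it locally finite and makes it a cover, to which the
  Lindelof property applies.
\<close>

lemma locally_finite_countable:
  fixes S :: "'a::second_countable_topology set"
  assumes "locally_finite_in (top_of_set S) \<A>"
  shows "countable \<A>"
proof -
  have "Lindelof_space (top_of_set S)"
    unfolding Lindelof_space_def
  proof (intro allI impI, elim conjE)
    fix \<U> assume "\<forall>U\<in>\<U>. openin (top_of_set S) U" "\<Union>\<U> = topspace (top_of_set S)"
    then show "\<exists>\<V>. countable \<V> \<and> \<V> \<subseteq> \<U> \<and> \<Union>\<V> = topspace (top_of_set S)"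
      using Lindelof_openin[of \<U> S] by metis
  qed
  moreover have "locally_finite_in (top_of_set S) (insert S \<A>)"
  proof -
    have "finite {A \<in> insert S \<A>. A \<inter> V \<noteq> {}}" if "finite {A \<in> \<A>. A \<inter> V \<noteq> {}}" for V
      using finite_subset[of "{A \<in> insert S \<A>. A \<inter> V \<noteq> {}}" "insert S {A \<in> \<A>. A \<inter> V \<noteq> {}}"] that
      by auto
    moreover have "\<Union>\<A> \<subseteq> S"
      and "\<And>x. x \<in> S \<Longrightarrow> \<exists>V. openin (top_of_set S) V \<and> x \<in> V \<and> finite {A \<in> \<A>. A \<inter> V \<noteq> {}}"
      using assms by (auto simp: locally_finite_in_def)
    ultimately show ?thesis unfolding locally_finite_in_def topspace_euclidean_subtopology
      by (intro conjI ballI) (blast, meson)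
  qed
  ultimately have "countable (insert S \<A>)"
    by (intro locally_finite_cover_of_Lindelof_space[of "top_of_set S"]) auto
  then show ?thesis by simp
qed

lemma countable_segment_endpoints:
  fixes E :: "'a::euclidean_space set"
  assumes "convex E" "bounded E" "aff_dim E = 1"
  shows "countable (E - rel_interior E)"
proof -
  have ne: "closure E \<noteq> {}" using assms(3) by auto
  have "collinear (closure E)" using assms(3) by (simp add: collinear_aff_dim)
  then obtain a b where ab: "closure E = closed_segment a b"
    using compact_convex_collinear_segment[OF ne] assms by (metis compact_closure convex_closure)
  have "a \<noteq> b" using assms(3) closure_aff_dim[of E] by (auto simp: ab)
  have "rel_interior E = open_segment a b"
    using convex_rel_interior_closure[OF assms(1)] \<open>a \<noteq> b\<close>
    by (simp add: ab rel_interior_closed_segment)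
  moreover have "E \<subseteq> closed_segment a b" using ab closure_subset by blast
  ultimately have "E - rel_interior E \<subseteq> {a, b}" by (auto simp: open_segment_def)
  then show ?thesis by (meson countable_finite finite.simps finite_subset)
qed

text \<open>
  A set of codimension two does not separate a convex open set: a segment between generic points of
  \<open>B\<close> misses the affine hull of \<open>E\<close>, so it cannot leave \<open>U\<close>.
\<close>

lemma convex_subset_closure_codim2:
  fixes B U E :: "'a::euclidean_space set"
  assumes B: "convex B" "open B" and fr: "B \<inter> frontier U \<subseteq> E"
    and E: "aff_dim E \<le> int DIM('a) - 2" and int: "B \<inter> interior U \<noteq> {}"
  shows "B \<subseteq> closure U"
proof (rule ccontr)
  assume "\<not> B \<subseteq> closure U"
  then have q0: "B - closure U \<noteq> {}" by blast
  have avoid: "\<exists>p\<in>A. p \<notin> affine hull S" if "open A" "A \<noteq> {}" "aff_dim S < DIM('a)" for A S :: "'a set"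
  proof (rule ccontr)
    assume "\<not> ?thesis"
    then have "A \<subseteq> affine hull S" by blast
    then have "A \<subseteq> interior (affine hull S)" using that(1) by (rule interior_maximal)
    moreover have "interior (affine hull S) = {}"
      using that(3) aff_dim_nonempty_interior[of "affine hull S"] by (auto simp: aff_dim_affine_hull)
    ultimately show False using that(2) by blast
  qed
  obtain p where p: "p \<in> B" "p \<in> interior U" "p \<notin> affine hull E"
    using avoid[of "B \<inter> interior U" E] B int E by auto
  have "aff_dim (insert p E) < DIM('a)" using E by (simp add: aff_dim_insert)
  then obtain q where q: "q \<in> B" "q \<notin> closure U" "q \<notin> affine hull (insert p E)"
    using avoid[of "B - closure U" "insert p E"] B q0 by auto
  have "p \<in> closed_segment p q \<inter> U" "q \<in> closed_segment p q - U"
    using p(2) q(2) interior_subset[of U] closure_subset[of U] by auto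
  then have "closed_segment p q \<inter> frontier U \<noteq> {}"
    by (intro connected_Int_frontier) blast+
  then obtain y where y: "y \<in> closed_segment p q" "y \<in> frontier U" by blast
  have "y \<in> E" using y fr B(1) p q by (meson IntI closed_segment_subset subsetD)
  then have yp: "y \<noteq> p" using p(3) hull_inc by metis
  obtain u where u: "y = (1 - u) *\<^sub>R p + u *\<^sub>R q" using y(1) by (auto simp: closed_segment_def)
  have "u \<noteq> 0" using u yp by auto
  then have "q = (1 - 1/u) *\<^sub>R p + (1/u) *\<^sub>R y" by (simp add: u algebra_simps)
  moreover have "p \<in> affine hull (insert p E)" "y \<in> affine hull (insert p E)"
    using \<open>y \<in> E\<close> by (auto intro: hull_inc)
  ultimately have "q \<in> affine hull (insert p E)"
    using mem_affine[OF affine_affine_hull, of p "insert p E" y "1 - 1/u" "1/u"] by simp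
  with q(3) show False ..
qed

context polyhedron
begin

lemma
  shows P_subset: "P \<subseteq> H3" and convex_P: "convex P"
    and closedin_P: "closedin (top_of_set H3) P" and interior_P: "interior P \<noteq> {}"
proof -
  obtain \<H> where H: "P = H3 \<inter> \<Inter>\<H>" "\<And>h. h \<in> \<H> \<Longrightarrow> \<exists>a b. a \<noteq> 0 \<and> h = {x. a \<bullet> x \<le> b}"
    and i: "interior P \<noteq> {}"
    using P_polyhedron unfolding convex_polyhedron_def by metis
  show "P \<subseteq> H3" "interior P \<noteq> {}" using H i by auto
  have "convex h \<and> closed h" if "h \<in> \<H>" for h
    using H(2)[OF that] convex_halfspace_le closed_halfspace_le by auto
  then show "convex P" "closedin (top_of_set H3) P"
    unfolding H(1) by (auto simp: H3_def intro!: convex_Int convex_Inter closedin_closed_Int)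
qed

lemma interior_dense: "P \<subseteq> closure (interior P)"
  using convex_closure_interior[OF convex_P interior_P] closure_subset by blast

lemma boundary_point_in_face:
  assumes "x \<in> P" "x \<notin> interior P"
  obtains F where "F \<in> faces" "x \<in> F"
proof -
  have "x \<in> H3 \<inter> frontier P"
    using assms P_subset closure_subset by (auto simp: frontier_def)
  then show thesis using faces_cover that by blast
qed

lemma face_subset:
  assumes "F \<in> faces"
  shows "F \<subseteq> P" "F \<inter> interior P = {}"
proof -
  have F: "F \<subseteq> H3 \<inter> frontier P" using assms faces_cover by blast
  then show "F \<inter> interior P = {}" by (auto simp: frontier_def)
  have "H3 \<inter> closure P \<subseteq> P"
  proof -
    obtain C where "closed C" "P = H3 \<inter> C" using closedin_P by (auto simp: closedin_closed)
    then show ?thesis using closure_minimal[of P C] by blast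
  qed
  then show "F \<subseteq> P" using F by (auto simp: frontier_def)
qed

text \<open>
  If an interior point of the segment were on the boundary of \<open>P\<close>, a supporting plane there would
  contain both ends of the segment, hence all of \<open>F\<close> because \<open>y\<close> is relatively interior to
  it, and also \<open>z\<close>: too much for a plane.
\<close>

lemma face_segment_interior:
  assumes F: "F \<in> faces" and y: "y \<in> rel_interior F" and z: "z \<in> P" "z \<notin> affine hull F"
    and w: "w \<in> open_segment y z"
  shows "w \<in> interior P"
proof (rule ccontr)
  assume "w \<notin> interior P"
  then have wr: "w \<notin> rel_interior P" using interior_P by (simp add: rel_interior_nonempty_interior)
  have yP: "y \<in> P" using F y face_subset rel_interior_subset by blast
  have wP: "w \<in> P" using w yP z(1) convex_P by (meson convex_contains_open_segment subsetD)
  obtain a where a: "a \<noteq> 0" "\<And>p. p \<in> P \<Longrightarrow> a \<bullet> w \<le> a \<bullet> p"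
    using supporting_hyperplane_rel_boundary[OF convex_P wP wr] by metis
  define T where "T = P \<inter> {p. a \<bullet> p = a \<bullet> w}"
  have T: "T face_of P" unfolding T_def
    by (rule face_of_Int_supporting_hyperplane_ge[OF convex_P]) (rule a(2))
  have "w \<in> T" using wP by (simp add: T_def)
  then have yz: "y \<in> T" "z \<in> T" using T yP z(1) w by (auto simp: face_of_def)
  then have "F \<subseteq> T" using subset_of_face_of[OF T] face_subset(1)[OF F] y by blast
  then have "insert z F \<subseteq> {p. a \<bullet> p = a \<bullet> w}" using yz by (auto simp: T_def)
  then have "aff_dim (insert z F) \<le> aff_dim {p. a \<bullet> p = a \<bullet> w}" by (rule aff_dim_subset)
  moreover have "aff_dim (insert z F) = 3"
    using face_shape[OF F] z(2) by (simp add: aff_dim_insert)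
  ultimately show False using a(1) by (simp add: aff_dim_hyperplane)
qed

text \<open>
  A second face through \<open>y\<close> that leaves the plane of \<open>F\<close> would run through the interior of
  \<open>P\<close>, and one inside that plane would overlap \<open>F\<close>.
\<close>

lemma unique_face_at_interior_point:
  assumes F: "F \<in> faces" "y \<in> rel_interior F" and F': "F' \<in> faces" "y \<in> F'"
  shows "F' = F"
proof (cases "F' \<subseteq> affine hull F")
  case False
  then obtain z where z: "z \<in> F'" "z \<notin> affine hull F" by blast
  have "y \<in> affine hull F" using F(2) rel_interior_subset[of F] hull_inc[of y F] by blast
  then have "y \<noteq> z" using z by auto
  then have m: "midpoint y z \<in> open_segment y z" by simp
  have "midpoint y z \<in> interior P"
    using face_segment_interior[OF F subsetD[OF face_subset(1)[OF F'(1)] z(1)] z(2) m] .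
  moreover have "midpoint y z \<in> F'"
    using m F'(2) z(1) face_shape[OF F'(1)] convex_contains_open_segment[of F'] by blast
  ultimately show ?thesis using face_subset(2)[OF F'(1)] by blast
next
  case True
  have c: "convex F'" "convex F" using face_shape F F' by auto
  have "openin (top_of_set (affine hull F)) (rel_interior F)" by (rule openin_rel_interior)
  then obtain O' where O': "open O'" "rel_interior F = affine hull F \<inter> O'"
    by (auto simp: openin_open)
  have "y \<in> closure (rel_interior F')"
    using F'(2) convex_closure_rel_interior[OF c(1)] closure_subset[of F'] by blast
  then have "O' \<inter> rel_interior F' \<noteq> {}"
    using O' F(2) open_Int_closure_eq_empty[OF O'(1)] by blast
  then have "rel_interior F \<inter> rel_interior F' \<noteq> {}"
    using O'(2) True rel_interior_subset[of F'] by blast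
  then show ?thesis using faces_disjoint F(1) F'(1) by (auto simp: pairwise_def disjnt_def)
qed

text \<open>
  This description of the relative interior refers only to incidence with edges, which the face
  pairings respect, so that they preserve relative interiors of faces.
\<close>

lemma face_interior_iff:
  assumes "F \<in> faces" "y \<in> F"
  shows "y \<in> rel_interior F \<longleftrightarrow> \<not> (\<exists>E\<in>edges. E \<subseteq> F \<and> y \<in> E)"
proof -
  have "y \<in> H3" using assms face_subset P_subset by blast
  moreover have "y \<in> closure F" using assms closure_subset by blast
  ultimately have "y \<notin> rel_interior F \<longleftrightarrow> y \<in> H3 \<inter> rel_frontier F" by (auto simp: rel_frontier_def)
  then show ?thesis using face_boundary[OF assms(1)] by auto
qed

text \<open>
  These include the vertices of \<open>P\<close>, around which the arrangement of tiles is not described by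
  a single edge cycle.
\<close>

definition endpoints :: "(real^3) set" where
  "endpoints = (\<Union>E\<in>edges. E - rel_interior E)"

lemma countable_endpoints: "countable endpoints"
proof -
  have "countable (E - rel_interior E)" if "E \<in> edges" for E
  proof (rule countable_segment_endpoints)
    show "convex E" "aff_dim E = 1" using edge_shape that by auto
    have "E \<subseteq> H3" using edge_shape[OF that] closedin_imp_subset by blast
    then show "bounded E" using bounded_subset by (auto simp: H3_def)
  qed
  then show ?thesis unfolding endpoints_def
    using locally_finite_countable[OF edges_locally_finite] by blast
qed

lemma unique_edge_at_point:
  assumes "E \<in> edges" "E' \<in> edges" "x \<in> E" "x \<in> E'" "x \<notin> endpoints"
  shows "E' = E"
proof -
  have "x \<in> rel_interior E \<inter> rel_interior E'" using assms by (auto simp: endpoints_def)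
  then show ?thesis using edges_disjoint assms(1,2) by (auto simp: pairwise_def disjnt_def)
qed

lemma edge_in_two_faces:
  assumes "E \<in> edges" "F \<in> faces" "E \<subseteq> F"
  shows "other_face faces E F \<in> faces" "E \<subseteq> other_face faces E F" "other_face faces E F \<noteq> F"
    "\<And>F'. F' \<in> faces \<Longrightarrow> E \<subseteq> F' \<Longrightarrow> F' = F \<or> F' = other_face faces E F"
proof -
  obtain A B where AB: "{F \<in> faces. E \<subseteq> F} = {A, B}" "A \<noteq> B"
    using edge_two_faces[OF assms(1)] by (auto simp: card_2_iff)
  have "F \<in> {A, B}" using AB(1)[symmetric] assms by simp
  then have "\<exists>F'. {F \<in> faces. E \<subseteq> F} = {F, F'} \<and> F' \<noteq> F"
    using AB by (elim insertE) (auto simp: insert_commute)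
  then obtain F' where F'0: "{F \<in> faces. E \<subseteq> F} = {F, F'}" "F' \<noteq> F" by blast
  have F': "H \<in> faces \<and> E \<subseteq> H \<longleftrightarrow> H = F \<or> H = F'" for H
    using F'0(1) by (metis (mono_tags, lifting) insert_iff mem_Collect_eq singletonD)
  have "other_face faces E F = F'"
    unfolding other_face_def using F' F'0(2) by (intro the_equality) (simp, metis)
  then show "other_face faces E F \<in> faces" "E \<subseteq> other_face faces E F" "other_face faces E F \<noteq> F"
    "\<And>F'. F' \<in> faces \<Longrightarrow> E \<subseteq> F' \<Longrightarrow> F' = F \<or> F' = other_face faces E F"
    using F' F'0(2) by metis+
qed

text \<open>
  The point cannot be relatively interior to \<open>F\<close>, since each of the two faces along \<open>E\<close> would
  then have to be \<open>F\<close>; so it is on an edge of \<open>F\<close>, and that edge is \<open>E\<close>.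
\<close>

lemma edge_subset_face_at_point:
  assumes E: "E \<in> edges" "x \<in> E" "x \<notin> endpoints" and F: "F \<in> faces" "x \<in> F"
  shows "E \<subseteq> F"
proof (cases "x \<in> rel_interior F")
  case True
  obtain A B where AB: "{F \<in> faces. E \<subseteq> F} = {A, B}" "A \<noteq> B"
    using edge_two_faces[OF E(1)] by (auto simp: card_2_iff)
  have "F' = F" if "F' \<in> {A, B}" for F'
    using that unique_face_at_interior_point[OF F(1) True] E(2) by (auto simp: AB(1)[symmetric])
  then have "A = F" "B = F" by simp_all
  then show ?thesis using AB(2) by simp
next
  case False
  then obtain E' where E': "E' \<in> edges" "E' \<subseteq> F" "x \<in> E'" using face_interior_iff[OF F] by auto
  then show ?thesis using unique_edge_at_point[OF E(1) E'(1) E(2) E'(3) E(3)] by simp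
qed

end

section \<open>The tiling by translates of the polyhedron\<close>

locale kleinian_polyhedron = fundamental_polyhedron +
  assumes subgroup_G: "subgroup G isom_H3"
begin

lemma G_isometry: "W \<in> G \<Longrightarrow> W \<in> carrier isom_H3"
  by (rule subgroup.mem_carrier[OF subgroup_G])

lemma G_permutes: "W \<in> G \<Longrightarrow> W permutes H3"
  using G_isometry by (simp add: isom_H3_simps)

lemma G_in_H3_iff [simp]: "W \<in> G \<Longrightarrow> W x \<in> H3 \<longleftrightarrow> x \<in> H3"
  using G_permutes by (simp add: permutes_in_image)

lemma id_in_G: "id \<in> G"
  using subgroup.one_closed[OF subgroup_G] by (simp add: isom_H3_simps)

lemma comp_in_G: "V \<in> G \<Longrightarrow> W \<in> G \<Longrightarrow> V \<circ> W \<in> G"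
  using subgroup.m_closed[OF subgroup_G] by (simp add: isom_H3_simps)

lemma inv_isom:
  assumes "W \<in> G"
  shows "inv\<^bsub>isom_H3\<^esub> W = inv_into UNIV W"
proof (rule group.inv_equality[OF group_isom_H3])
  show "inv_into UNIV W \<otimes>\<^bsub>isom_H3\<^esub> W = \<one>\<^bsub>isom_H3\<^esub>"
    using permutes_inv_o(2)[OF G_permutes[OF assms]] by (simp add: isom_H3_simps)
qed (use assms G_isometry isom_H3_inverse in auto)

lemma inv_in_G: "W \<in> G \<Longrightarrow> inv_into UNIV W \<in> G"
  using subgroup.m_inv_closed[OF subgroup_G] by (simp add: inv_isom[symmetric])

lemma G_inverse [simp]:
  assumes "W \<in> G"
  shows "W (inv_into UNIV W x) = x" "inv_into UNIV W (W x) = x"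
  using permutes_inverses[OF G_permutes[OF assms]] by auto

lemma continuous_on_G: "W \<in> G \<Longrightarrow> continuous_on H3 W"
  by (rule continuous_at_imp_continuous_on)
    (use G_isometry has_derivative_continuous in \<open>fastforce simp: isom_H3_simps\<close>)

lemma vimage_subset_H3: "W \<in> G \<Longrightarrow> U \<subseteq> H3 \<Longrightarrow> W -` U \<subseteq> H3"
  by (auto simp: subset_iff)

lemma open_vimage_G:
  assumes "W \<in> G" "open U" "U \<subseteq> H3"
  shows "open (W -` U)"
proof -
  have "open (H3 \<inter> W -` U)"
    using continuous_on_G[OF assms(1)] assms(2) by (intro continuous_open_preimage) (auto simp: H3_def)
  moreover have "H3 \<inter> W -` U = W -` U" using vimage_subset_H3[OF assms(1,3)] by blast
  ultimately show ?thesis by simp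
qed

lemma interior_vimage_G:
  assumes "W \<in> G" "W y \<in> interior S" "S \<subseteq> H3"
  shows "y \<in> interior (W -` S)"
proof -
  have "open (W -` interior S)"
    using assms interior_subset[of S] by (intro open_vimage_G) auto
  moreover have "W -` interior S \<subseteq> W -` S" using interior_subset[of S] by blast
  ultimately show ?thesis using assms(2) by (meson interiorI vimageI)
qed

text \<open>
  A tile is written as a preimage \<open>W -` P\<close>, the translate of \<open>P\<close> by the inverse of \<open>W\<close>.
  Then the composition of the face pairings met along a path from \<open>P\<close> into a tile is the
  \<open>W\<close> of that tile.
\<close>

lemma tile_eq_translate:
  assumes "W \<in> G"
  shows "W -` P = inv_into UNIV W ` P"
  using bij_vimage_eq_inv_image[OF permutes_bij[OF G_permutes[OF assms]]] .

lemma closedin_tile: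
  assumes "W \<in> G"
  shows "closedin (top_of_set H3) (W -` P)"
proof -
  obtain C where C: "closed C" "P = H3 \<inter> C" using closedin_P by (auto simp: closedin_closed)
  have "closedin (top_of_set H3) (H3 \<inter> W -` C)"
    using continuous_on_G[OF assms] C(1) by (rule continuous_closedin_preimage)
  moreover have "H3 \<inter> W -` C = W -` P" using C(2) assms by auto
  ultimately show ?thesis by simp
qed

lemma tile_interior_meets_nhd:
  assumes "W \<in> G" "y \<in> W -` P" "open N" "y \<in> N"
  shows "N \<inter> interior (W -` P) \<noteq> {}"
proof -
  let ?V = "inv_into UNIV W"
  have "open (?V -` (N \<inter> H3))"
    using assms inv_in_G by (intro open_vimage_G) (auto simp: H3_def)
  moreover have "W y \<in> ?V -` (N \<inter> H3)" using assms P_subset G_in_H3_iff[of W y] by auto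
  moreover have "W y \<in> closure (interior P)" using assms(2) interior_dense by auto
  ultimately have "?V -` (N \<inter> H3) \<inter> interior P \<noteq> {}"
    using open_Int_closure_eq_empty[of "?V -` (N \<inter> H3)" "interior P"] by blast
  then obtain z where z: "?V z \<in> N" "z \<in> interior P" by blast
  then have "?V z \<in> interior (W -` P)"
    using assms(1) P_subset by (intro interior_vimage_G) auto
  with z(1) show ?thesis by blast
qed

lemma tiles_overlap_imp_eq:
  assumes "V \<in> G" "W \<in> G" "interior (V -` P) \<inter> interior (W -` P) \<noteq> {}"
  shows "V = W"
proof (rule ccontr)
  assume ne: "V \<noteq> W"
  have "inv_into UNIV V \<noteq> inv_into UNIV W"
    using ne permutes_inv_inv[OF G_permutes[OF assms(1)]] permutes_inv_inv[OF G_permutes[OF assms(2)]]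
    by metis
  then show False
    using translates_disjoint[OF inv_in_G inv_in_G] assms by (simp add: tile_eq_translate)
qed

text \<open>
  A tile through \<open>x\<close> has interior points arbitrarily close to \<open>x\<close>; these lie in one of the given
  tiles, and distinct tiles do not overlap. This is how a neighbourhood of \<open>x\<close> made of known tiles
  identifies every element of \<open>G\<close> that fixes \<open>x\<close>.
\<close>

lemma tile_in_neighbouring_tiles:
  assumes "\<W> \<subseteq> G" "x \<in> interior (\<Union>W\<in>\<W>. W -` P)" "V \<in> G" "x \<in> V -` P"
  shows "V \<in> \<W>"
proof -
  let ?U = "\<Union>W\<in>\<W>. W -` P"
  obtain y where y: "y \<in> interior ?U" "y \<in> interior (V -` P)"
    using tile_interior_meets_nhd[OF assms(3,4) open_interior assms(2)] by blast
  then obtain W where W: "W \<in> \<W>" "y \<in> W -` P" using interior_subset[of ?U] by blast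
  have "interior (V -` P) \<inter> interior (W -` P) \<noteq> {}"
    using tile_interior_meets_nhd[of W y "interior (V -` P)"] W y assms(1) by auto
  then have "V = W" using tiles_overlap_imp_eq[OF assms(3)] assms(1) W by blast
  with W show ?thesis by simp
qed

lemma gen_in_G: "F \<in> faces \<Longrightarrow> gen F \<in> G"
  using pairing by blast

lemma partner_face: "F \<in> faces \<Longrightarrow> gen F ` F \<in> faces" "F \<in> faces \<Longrightarrow> gen F ` F \<noteq> F"
  using pairing by blast+

lemma gen_partner: "F \<in> faces \<Longrightarrow> gen (gen F ` F) = inv_into UNIV (gen F)"
  using pairing_inverse inv_isom[OF gen_in_G] by simp

lemma adjacent_tile_meets:
  assumes "F \<in> faces"
  shows "gen F -` P \<inter> P = F"
proof -
  have "gen (gen F ` F) ` P \<inter> P = gen (gen F ` F) ` (gen F ` F)"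
    by (rule pairing_meet[OF partner_face(1)[OF assms]])
  then show ?thesis
    using assms gen_in_G by (simp add: gen_partner tile_eq_translate image_image)
qed

lemma gen_rel_interior:
  assumes F: "F \<in> faces" and y: "y \<in> rel_interior F"
  shows "gen F y \<in> rel_interior (gen F ` F)"
proof (rule ccontr)
  assume neg: "gen F y \<notin> rel_interior (gen F ` F)"
  have yF: "y \<in> F" using y rel_interior_subset[of F] by blast
  then obtain E where E: "E \<in> edges" "E \<subseteq> gen F ` F" "gen F y \<in> E"
    using face_interior_iff[OF partner_face(1)[OF F], of "gen F y"] neg by auto
  have "gen (gen F ` F) ` E \<in> edges"
    by (rule pairing_edges[OF E(1) partner_face(1)[OF F] E(2)])
  moreover have "gen (gen F ` F) ` E \<subseteq> F"
    using E(2) F gen_in_G by (force simp: gen_partner)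
  moreover have "y \<in> gen (gen F ` F) ` E"
    using E(3) F gen_in_G by (force simp: gen_partner)
  ultimately show False using face_interior_iff[OF F yF] y by blast
qed

lemma tile_boundary:
  assumes "W \<in> G" "y \<in> W -` P" "y \<notin> interior (W -` P)"
  obtains F where "F \<in> faces" "W y \<in> F"
proof -
  have "W y \<notin> interior P" using interior_vimage_G[OF assms(1) _ P_subset] assms(3) by blast
  then show thesis using boundary_point_in_face[of "W y"] assms(2) that by auto
qed

text \<open>
  Near \<open>y\<close> the boundaries of \<open>P\<close> and of the tile across \<open>F\<close> are both contained in
  \<open>F\<close>. So each of the two open half-balls cut off by the plane of \<open>F\<close> is either inside
  or outside each tile. Each tile contains at least one of them, and they cannot share one.
\<close>

lemma face_neighbourhood:
  assumes F: "F \<in> faces" and y: "y \<in> rel_interior F"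
  shows "y \<in> interior (P \<union> gen F -` P)"
proof -
  define g where "g = gen F"
  have g: "g \<in> G" using F gen_in_G by (simp add: g_def)
  have yF: "y \<in> F" using y rel_interior_subset[of F] by blast
  then have yH: "y \<in> H3" using face_subset(1)[OF F] P_subset by blast
  have gy: "g y \<in> rel_interior (g ` F)" using gen_rel_interior[OF F y] by (simp add: g_def)
  have closed_faces: "\<And>A. A \<in> faces \<Longrightarrow> closedin (top_of_set H3) A" using face_shape by blast
  have H3: "open H3" by (simp add: H3_def)
  obtain U1 where U1: "open U1" "y \<in> U1" "U1 \<subseteq> H3"
    "\<And>A z. A \<in> faces \<Longrightarrow> z \<in> A \<Longrightarrow> z \<in> U1 \<Longrightarrow> y \<in> A"
    using locally_finite_isolate[OF faces_locally_finite H3 yH closed_faces] by blast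
  obtain U2 where U2: "open U2" "g y \<in> U2" "U2 \<subseteq> H3"
    "\<And>A z. A \<in> faces \<Longrightarrow> z \<in> A \<Longrightarrow> z \<in> U2 \<Longrightarrow> g y \<in> A"
    using locally_finite_isolate[OF faces_locally_finite H3 _ closed_faces, of "g y"] yH g by auto
  obtain O' where O': "open O'" "rel_interior F = affine hull F \<inter> O'"
    using openin_rel_interior[of F] by (auto simp: openin_open)
  have "open (U1 \<inter> g -` U2 \<inter> O')"
    using U1(1) O'(1) open_vimage_G[OF g U2(1,3)] by (intro open_Int)
  moreover have "y \<in> U1 \<inter> g -` U2 \<inter> O'"
    using U1(2) U2(2) O'(2) y by simp
  ultimately obtain e where e: "e > 0" "ball y e \<subseteq> U1 \<inter> g -` U2 \<inter> O'"
    by (rule openE)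
  define B where "B = ball y e"
  have boundary_B: "z \<in> F" if z: "z \<in> B" and W: "W = id \<or> W = g" and zW: "z \<in> frontier (W -` P)" for z W
  proof -
    have WG: "W \<in> G" using W g id_in_G by auto
    have zH: "z \<in> H3" using z e(2) U1(3) by (auto simp: B_def)
    obtain C where C: "closed C" "W -` P = H3 \<inter> C"
      using closedin_tile[OF WG] by (auto simp: closedin_closed)
    have "z \<in> C" using zW C closure_minimal[of "W -` P" C] by (auto simp: frontier_def)
    then have "z \<in> W -` P" "z \<notin> interior (W -` P)" using zW zH C by (auto simp: frontier_def)
    then obtain F1 where F1: "F1 \<in> faces" "W z \<in> F1" using tile_boundary[OF WG] by blast
    show ?thesis using W
    proof
      assume "W = id"
      then have "y \<in> F1" using U1(4) F1 z e(2) by (auto simp: B_def)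
      then have "F1 = F" using unique_face_at_interior_point[OF F y F1(1)] by simp
      with F1 \<open>W = id\<close> show ?thesis by simp
    next
      assume "W = g"
      then have "g y \<in> F1" using U2(4)[OF F1] z e(2) by (auto simp: B_def)
      then have "F1 = g ` F"
        using unique_face_at_interior_point[OF _ gy F1(1)] partner_face(1)[OF F] by (simp add: g_def)
      then obtain u where "u \<in> F" "g z = g u" using F1 \<open>W = g\<close> by auto
      then show ?thesis using G_inverse(2)[OF g] by metis
    qed
  qed
  have "aff_dim F = int DIM(real^3) - 1" using face_shape[OF F] by simp
  then obtain a b where ab: "a \<noteq> 0" "affine hull F = {z. a \<bullet> z = b}"
    using aff_dim_eq_hyperplane[of F] by auto
  define Bp where "Bp = B \<inter> {z. a \<bullet> z > b}"
  define Bm where "Bm = B \<inter> {z. a \<bullet> z < b}"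
  have opn: "open Bp" "open Bm"
    by (auto simp: Bp_def Bm_def B_def open_halfspace_gt open_halfspace_lt)
  have conn: "connected Bp" "connected Bm"
    unfolding Bp_def Bm_def B_def
    by (intro convex_connected convex_Int convex_ball convex_halfspace_gt convex_halfspace_lt)+
  have off: "z \<notin> F" if "z \<in> Bp \<union> Bm" for z
    using that ab(2) hull_subset[of F affine] by (auto simp: Bp_def Bm_def)
  \<comment> \<open>A half-ball that meets a tile is contained in it, since it is connected and misses the boundary.\<close>
  have contain: "H \<subseteq> W -` P" if "H = Bp \<or> H = Bm" "W = id \<or> W = g" "H \<inter> W -` P \<noteq> {}" for H W
  proof (rule ccontr)
    assume "\<not> H \<subseteq> W -` P"
    then have "H \<inter> frontier (W -` P) \<noteq> {}"
      using that(1,3) conn by (intro connected_Int_frontier) auto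
    then obtain z where "z \<in> H" "z \<in> frontier (W -` P)" by blast
    then show False using boundary_B[of z W] off[of z] that(1,2) by (auto simp: Bp_def Bm_def)
  qed
  have one: "\<exists>H. (H = Bp \<or> H = Bm) \<and> H \<noteq> {} \<and> H \<subseteq> W -` P" if W: "W = id \<or> W = g" for W
  proof -
    have WG: "W \<in> G" using W g id_in_G by auto
    have "y \<in> W -` P"
      using W face_subset(1)[OF F] yF adjacent_tile_meets[OF F] by (auto simp: g_def)
    then have "B \<inter> interior (W -` P) \<noteq> {}"
      using e(1) by (intro tile_interior_meets_nhd[OF WG]) (auto simp: B_def)
    moreover have "open (B \<inter> interior (W -` P))" unfolding B_def by (intro open_Int open_ball open_interior)
    ultimately have "\<not> B \<inter> interior (W -` P) \<subseteq> {z. a \<bullet> z = b}"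
      using interior_maximal[of "B \<inter> interior (W -` P)" "{z. a \<bullet> z = b}"] ab(1)
      by (auto simp: interior_hyperplane)
    then obtain z where z: "z \<in> B" "z \<in> W -` P" "a \<bullet> z \<noteq> b" using interior_subset[of "W -` P"] by blast
    then have "z \<in> Bp \<or> z \<in> Bm" by (auto simp: Bp_def Bm_def)
    then show ?thesis
    proof
      assume "z \<in> Bp"
      then show ?thesis using contain[of Bp W] W z(2) by blast
    next
      assume "z \<in> Bm"
      then show ?thesis using contain[of Bm W] W z(2) by blast
    qed
  qed
  obtain H where H: "H = Bp \<or> H = Bm" "H \<noteq> {}" "H \<subseteq> id -` P" using one[of id] by blast
  obtain K where K: "K = Bp \<or> K = Bm" "K \<noteq> {}" "K \<subseteq> g -` P" using one[of g] by blast
  have "H \<noteq> K"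
  proof
    assume "H = K"
    then have "H \<subseteq> interior (id -` P) \<inter> interior (g -` P)"
      using H K opn interior_maximal[of H "id -` P"] interior_maximal[of H "g -` P"] by blast
    then have "id = g" using tiles_overlap_imp_eq[OF id_in_G g] H(2) by blast
    then show False using partner_face(2)[OF F] by (simp add: g_def)
  qed
  then have "Bp \<union> Bm \<subseteq> P \<union> g -` P" using H K by auto
  moreover have "B \<inter> {z. a \<bullet> z = b} \<subseteq> P"
  proof
    fix z assume "z \<in> B \<inter> {z. a \<bullet> z = b}"
    then have "z \<in> rel_interior F" using O'(2) ab(2) e(2) by (auto simp: B_def)
    then show "z \<in> P" using rel_interior_subset[of F] face_subset(1)[OF F] by blast
  qed
  moreover have "B \<subseteq> Bp \<union> Bm \<union> (B \<inter> {z. a \<bullet> z = b})" by (auto simp: Bp_def Bm_def)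
  ultimately have "B \<subseteq> P \<union> g -` P" by blast
  then show ?thesis using e(1) by (auto simp: B_def g_def mem_interior)
qed

end

section \<open>Tiles around an edge\<close>

context kleinian_polyhedron
begin

abbreviation step :: "(real^3) set \<times> (real^3) set \<Rightarrow> (real^3) set \<times> (real^3) set" where
  "step \<equiv> edge_step faces gen"

text \<open>
  One step of an edge cycle is the product of two involutions on incident pairs of an edge and a
  face: crossing to the partner face, and turning around the edge to its other face.
\<close>

definition flag :: "(real^3) set \<times> (real^3) set \<Rightarrow> bool" where
  "flag s \<longleftrightarrow> fst s \<in> edges \<and> snd s \<in> faces \<and> fst s \<subseteq> snd s"

definition turn :: "(real^3) set \<times> (real^3) set \<Rightarrow> (real^3) set \<times> (real^3) set" where
  "turn s = (fst s, other_face faces (fst s) (snd s))"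

definition cross :: "(real^3) set \<times> (real^3) set \<Rightarrow> (real^3) set \<times> (real^3) set" where
  "cross s = (gen (snd s) ` fst s, gen (snd s) ` snd s)"

lemma step_eq: "step s = turn (cross s)"
  by (simp add: edge_step_def turn_def cross_def split_beta)

lemma fst_step: "fst (step s) = gen (snd s) ` fst s"
  by (simp add: step_eq turn_def cross_def)

lemma flag_turn:
  assumes "flag s"
  shows "flag (turn s)" "turn (turn s) = s" "turn s \<noteq> s"
proof -
  note o = edge_in_two_faces[of "fst s" "snd s"]
  show f: "flag (turn s)" and "turn s \<noteq> s"
    using assms o by (auto simp: flag_def turn_def prod_eq_iff)
  have "other_face faces (fst s) (other_face faces (fst s) (snd s)) = snd s"
    using edge_in_two_faces(4)[of "fst (turn s)" "snd (turn s)" "snd s"] f assms o(3)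
    by (auto simp: flag_def turn_def)
  then show "turn (turn s) = s" by (simp add: turn_def)
qed

lemma flag_cross:
  assumes "flag s"
  shows "flag (cross s)" "cross (cross s) = s" "cross s \<noteq> s"
proof -
  have s: "fst s \<in> edges" "snd s \<in> faces" "fst s \<subseteq> snd s" using assms by (auto simp: flag_def)
  show "flag (cross s)"
    using s pairing_edges[OF s] partner_face(1)[OF s(2)] by (auto simp: flag_def cross_def)
  show "cross s \<noteq> s" using partner_face(2)[OF s(2)] by (auto simp: cross_def prod_eq_iff)
  show "cross (cross s) = s"
    using s(2) gen_in_G[OF s(2)] by (simp add: cross_def gen_partner image_image)
qed

lemma flag_step_power: "flag s \<Longrightarrow> flag ((step ^^ n) s)"
  by (induction n) (auto simp: step_eq flag_turn flag_cross)

text \<open>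
  Otherwise \<open>s\<close> would be fixed by \<open>turn\<close> composed with \<open>n\<close> steps. That is an
  alternating word of odd length in two involutions, hence conjugate to one of them, and neither fixes
  a flag: every face is paired with a different one, and an edge has two different faces.
\<close>

lemma step_power_ne_turn: "flag s \<Longrightarrow> (step ^^ n) s \<noteq> turn s"
proof (induction n arbitrary: s rule: induct_nat_012)
  case 0
  then show ?case using flag_turn(3)[of s] by auto
next
  case 1
  show ?case
  proof
    assume "(step ^^ Suc 0) s = turn s"
    then have "turn (turn (cross s)) = turn (turn s)" by (simp add: step_eq)
    then show False using 1 flag_turn(2) flag_cross(1,3) by simp
  qed
next
  case (ge2 n)
  define t where "t = step s"
  define u where "u = (step ^^ n) t"
  have t: "flag t" using flag_step_power[OF ge2.prems, of 1] by (simp add: t_def)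
  have u: "flag u" using flag_step_power[OF t] by (simp add: u_def)
  show ?case
  proof
    assume "(step ^^ Suc (Suc n)) s = turn s"
    then have "turn (cross u) = turn s" by (simp add: u_def t_def step_eq[symmetric] funpow_swap1)
    then have "cross u = s" using flag_turn(2) flag_cross(1)[OF u] ge2.prems by metis
    then have "u = cross s" using flag_cross(2)[OF u] by simp
    also have "\<dots> = turn t"
      using flag_turn(2)[OF flag_cross(1)[OF ge2.prems]] by (simp add: t_def step_eq)
    finally show False using ge2.IH(1)[OF t] by (simp add: u_def)
  qed
qed

text \<open>
  The edge cycle stops when the edge recurs. This shows that the face recurs at the same time, so
  that the cycle really closes up and can be iterated.
\<close>

lemma return_to_flag:
  assumes "flag s" "fst ((step ^^ n) s) = fst s"
  shows "(step ^^ n) s = s"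
proof -
  have "flag ((step ^^ n) s)" by (rule flag_step_power[OF assms(1)])
  then have "snd ((step ^^ n) s) = snd s \<or> snd ((step ^^ n) s) = snd (turn s)"
    using edge_in_two_faces(4)[of "fst s" "snd s" "snd ((step ^^ n) s)"] assms
    by (auto simp: flag_def turn_def)
  then show ?thesis using step_power_ne_turn[OF assms(1), of n] assms(2)
    by (auto simp: prod_eq_iff turn_def)
qed

text \<open>
  The product of the face pairings along the first \<open>n\<close> steps from the flag \<open>s\<close>. The tiles
  \<open>holonomy s n -` P\<close> are those met successively when turning around the edge of \<open>s\<close>.
\<close>

definition holonomy :: "(real^3) set \<times> (real^3) set \<Rightarrow> nat \<Rightarrow> real^3 \<Rightarrow> real^3" where
  "holonomy s n = word_map gen (map (\<lambda>i. snd ((step ^^ i) s)) [0..<n])"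

lemma holonomy_0 [simp]: "holonomy s 0 = id"
  by (simp add: holonomy_def word_map_def)

lemma holonomy_Suc: "holonomy s (Suc n) = gen (snd ((step ^^ n) s)) \<circ> holonomy s n"
  by (simp add: holonomy_def word_map_def)

lemma holonomy_add: "holonomy s (k + n) = holonomy ((step ^^ n) s) k \<circ> holonomy s n"
  by (induction k) (simp_all add: holonomy_Suc funpow_add o_assoc)

lemma holonomy_in_G: "flag s \<Longrightarrow> holonomy s n \<in> G"
proof (induction n)
  case (Suc n)
  then have "snd ((step ^^ n) s) \<in> faces" using flag_step_power by (auto simp: flag_def)
  then show ?case using Suc unfolding holonomy_Suc by (intro comp_in_G gen_in_G)
qed (simp add: id_in_G)

lemma holonomy_image: "holonomy s n ` fst s = fst ((step ^^ n) s)"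
proof (induction n)
  case (Suc n)
  have "holonomy s (Suc n) ` fst s = gen (snd ((step ^^ n) s)) ` fst ((step ^^ n) s)"
    by (simp only: holonomy_Suc image_comp[symmetric] Suc)
  then show ?case by (simp add: fst_step)
qed simp

lemma holonomy_multiple:
  assumes "(step ^^ n) s = s"
  shows "holonomy s (n * k) = holonomy s n ^^ k" "(step ^^ (n * k)) s = s"
proof -
  show s: "(step ^^ (n * k)) s = s" for k
    by (induction k) (simp_all add: funpow_add assms)
  show "holonomy s (n * k) = holonomy s n ^^ k"
  proof (induction k)
    case (Suc k)
    then show ?case using holonomy_add[of s n "n * k"] s[of k] by simp
  qed simp
qed

lemma holonomy_mod:
  assumes "(step ^^ n) s = s" "holonomy s n = id"
  shows "holonomy s (i mod n) = holonomy s i"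
proof -
  have "holonomy s (i mod n + n * (i div n)) = holonomy s (i mod n) \<circ> holonomy s n ^^ (i div n)"
    using holonomy_add[of s "i mod n" "n * (i div n)"] holonomy_multiple[OF assms(1), of "i div n"]
    by simp
  then show ?thesis by (simp add: assms(2))
qed

text \<open>
  Among the tiles around the edge, each has both of its neighbours: across one face lies the next
  tile, and across the other the previous one.
\<close>

lemma holonomy_adjacent:
  assumes s: "flag s" and n: "n > 0" "(step ^^ n) s = s" "holonomy s n = id"
    and F: "F \<in> faces" "fst ((step ^^ i) s) \<subseteq> F"
  obtains j where "holonomy s j = gen F \<circ> holonomy s i"
proof -
  have fi: "flag ((step ^^ i) s)" by (rule flag_step_power[OF s])
  then consider "F = snd ((step ^^ i) s)" | "F = snd (turn ((step ^^ i) s))"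
    using edge_in_two_faces(4)[of "fst ((step ^^ i) s)" "snd ((step ^^ i) s)" F] F
    by (auto simp: flag_def turn_def)
  then show thesis
  proof cases
    case 1
    then show thesis using that[of "Suc i"] by (simp add: holonomy_Suc)
  next
    case 2
    \<comment> \<open>The previous index, shifted by a period because \<open>i\<close> may be zero.\<close>
    define j where "j = i + (n - 1)"
    define t where "t = (step ^^ j) s"
    have j: "Suc j = i + n" using n(1) by (simp add: j_def)
    have t: "flag t" using flag_step_power[OF s] by (simp add: t_def)
    have "step t = (step ^^ Suc j) s" by (simp add: t_def)
    also have "\<dots> = (step ^^ i) s" unfolding j by (simp add: funpow_add n(2))
    finally have "step t = (step ^^ i) s" .
    then have "turn ((step ^^ i) s) = cross t"
      using flag_turn(2)[OF flag_cross(1)[OF t]] by (simp add: step_eq)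
    then have Ft: "F = gen (snd t) ` snd t" using 2 by (simp add: cross_def)
    have st: "snd t \<in> faces" using t by (simp add: flag_def)
    have "holonomy s i = holonomy s (i + n)" using holonomy_add[of s i n] n by simp
    also have "\<dots> = gen (snd t) \<circ> holonomy s j" using holonomy_Suc[of s j] by (simp add: j t_def)
    finally have "gen F \<circ> holonomy s i = holonomy s j"
      using st gen_in_G[OF st] by (simp add: Ft gen_partner fun_eq_iff)
    then show thesis using that by simp
  qed
qed

lemma edge_isolating_neighbourhood:
  assumes E: "E \<in> edges" "x \<in> E" "x \<notin> endpoints"
  obtains U where "open U" "x \<in> U" "U \<subseteq> H3"
    "\<And>F y. F \<in> faces \<Longrightarrow> y \<in> F \<Longrightarrow> y \<in> U \<Longrightarrow> E \<subseteq> F"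
    "\<And>E' y. E' \<in> edges \<Longrightarrow> y \<in> E' \<Longrightarrow> y \<in> U \<Longrightarrow> E' = E"
proof -
  have H3: "open H3" by (simp add: H3_def)
  have xH: "x \<in> H3" using edge_shape[OF E(1)] E(2) closedin_imp_subset by blast
  have cf: "\<And>A. A \<in> faces \<Longrightarrow> closedin (top_of_set H3) A"
    and ce: "\<And>A. A \<in> edges \<Longrightarrow> closedin (top_of_set H3) A"
    using face_shape edge_shape by blast+
  obtain U1 where U1: "open U1" "x \<in> U1" "U1 \<subseteq> H3"
    "\<And>A z. A \<in> faces \<Longrightarrow> z \<in> A \<Longrightarrow> z \<in> U1 \<Longrightarrow> x \<in> A"
    using locally_finite_isolate[OF faces_locally_finite H3 xH cf] by blast
  obtain U2 where U2: "open U2" "x \<in> U2" "U2 \<subseteq> H3"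
    "\<And>A z. A \<in> edges \<Longrightarrow> z \<in> A \<Longrightarrow> z \<in> U2 \<Longrightarrow> x \<in> A"
    using locally_finite_isolate[OF edges_locally_finite H3 xH ce] by blast
  show thesis
  proof (rule that[of "U1 \<inter> U2"])
    show "open (U1 \<inter> U2)" "x \<in> U1 \<inter> U2" "U1 \<inter> U2 \<subseteq> H3"
      using U1(1-3) U2(1-3) by auto
    show "E \<subseteq> F" if "F \<in> faces" "y \<in> F" "y \<in> U1 \<inter> U2" for F y
      using edge_subset_face_at_point[OF E that(1)] U1(4)[OF that(1,2)] that(3) by blast
    show "E' = E" if "E' \<in> edges" "y \<in> E'" "y \<in> U1 \<inter> U2" for E' y
      using unique_edge_at_point[OF E(1) that(1) E(2) _ E(3)] U2(4)[OF that(1,2)] that(3) by blast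
  qed
qed

text \<open>
  Let \<open>T\<close> be the union of the tiles around the edge. Near \<open>x\<close> a boundary point of \<open>T\<close> off the
  edge is relatively interior to a face of some tile, but the tile across that face also belongs to
  \<open>T\<close>, a contradiction. So the boundary of \<open>T\<close> near \<open>x\<close> has codimension two and cannot
  separate a ball around \<open>x\<close>. No angles have to be measured.
\<close>

lemma edge_neighbourhood:
  assumes s: "flag s" and n: "n > 0" "(step ^^ n) s = s" "holonomy s n = id"
    and x: "x \<in> fst s" and generic: "\<And>W. W \<in> G \<Longrightarrow> W x \<notin> endpoints"
  shows "x \<in> interior (\<Union>W\<in>holonomy s ` {..<n}. W -` P)"
proof -
  define W where "W = holonomy s"
  define E where "E = (\<lambda>i. fst ((step ^^ i) s))"
  have WG: "W i \<in> G" for i using holonomy_in_G[OF s] by (simp add: W_def)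
  have E: "E i \<in> edges" for i using flag_step_power[OF s] by (simp add: E_def flag_def)
  have WE: "W i ` fst s = E i" for i by (simp add: W_def E_def holonomy_image)
  have Wx: "W i x \<in> E i" for i using WE[of i] x by blast
  have "\<exists>U. open U \<and> W i x \<in> U \<and> U \<subseteq> H3 \<and> (\<forall>F y. F \<in> faces \<longrightarrow> y \<in> F \<longrightarrow> y \<in> U \<longrightarrow> E i \<subseteq> F) \<and>
      (\<forall>E' y. E' \<in> edges \<longrightarrow> y \<in> E' \<longrightarrow> y \<in> U \<longrightarrow> E' = E i)" for i
    by (rule edge_isolating_neighbourhood[OF E[of i] Wx[of i] generic[OF WG[of i]]]) blast
  then obtain U where U: "\<And>i. open (U i)" "\<And>i. W i x \<in> U i" "\<And>i. U i \<subseteq> H3"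
      "\<And>i F y. F \<in> faces \<Longrightarrow> y \<in> F \<Longrightarrow> y \<in> U i \<Longrightarrow> E i \<subseteq> F"
      "\<And>i E' y. E' \<in> edges \<Longrightarrow> y \<in> E' \<Longrightarrow> y \<in> U i \<Longrightarrow> E' = E i"
    by metis
  have "open (\<Inter>i<n. W i -` U i)"
    by (intro open_INT ballI open_vimage_G WG U(1,3)) simp
  moreover have "x \<in> (\<Inter>i<n. W i -` U i)" using U(2) by simp
  ultimately obtain e where e: "e > 0" "ball x e \<subseteq> (\<Inter>i<n. W i -` U i)" by (rule openE)
  define T where "T = (\<Union>i<n. W i -` P)"
  have tile_T: "W j -` P \<subseteq> T" for j
  proof -
    have "W j = W (j mod n)" using holonomy_mod[OF n(2,3)] by (simp add: W_def)
    then show ?thesis using n(1) by (auto simp: T_def intro!: bexI[of _ "j mod n"])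
  qed
  have BU: "W i y \<in> U i" if "y \<in> ball x e" "i < n" for i y using e(2) that by auto
  have BH: "ball x e \<subseteq> H3"
  proof
    fix y assume "y \<in> ball x e"
    then show "y \<in> H3" using BU[of y 0] n(1) U(3)[of 0] by (auto simp: W_def)
  qed
  have "closedin (top_of_set H3) T"
    unfolding T_def by (intro closedin_Union) (auto intro!: closedin_tile WG)
  then obtain C where C: "closed C" "T = H3 \<inter> C" by (auto simp: closedin_closed)
  have closure_T: "ball x e \<inter> closure T \<subseteq> T"
    using C BH closure_minimal[of T C] by blast
  have frontier_T: "ball x e \<inter> frontier T \<subseteq> fst s"
  proof (rule subsetI, rule ccontr)
    fix y assume y: "y \<in> ball x e \<inter> frontier T" and ys: "y \<notin> fst s"
    then have yT: "y \<in> T" "y \<notin> interior T" using closure_T by (auto simp: frontier_def)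
    then obtain i where i: "i < n" "y \<in> W i -` P" by (auto simp: T_def)
    have int_mono: "S \<subseteq> T \<Longrightarrow> y \<notin> interior S" for S using yT(2) interior_mono by blast
    then have "y \<notin> interior (W i -` P)" using tile_T by blast
    then obtain F where F: "F \<in> faces" "W i y \<in> F" using tile_boundary[OF WG i(2)] by blast
    have Uy: "W i y \<in> U i" using BU y i(1) by blast
    have EF: "E i \<subseteq> F" by (rule U(4)[OF F Uy])
    have "W i y \<notin> E i"
    proof
      assume "W i y \<in> E i"
      then obtain u where "u \<in> fst s" "W i y = W i u" using WE[of i] by auto
      then show False using ys G_inverse(2)[OF WG[of i]] by metis
    qed
    then have "W i y \<in> rel_interior F"
      using face_interior_iff[OF F] U(5)[OF _ _ Uy] by blast
    then have "W i y \<in> interior (P \<union> gen F -` P)" by (rule face_neighbourhood[OF F(1)])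
    then have yi: "y \<in> interior (W i -` (P \<union> gen F -` P))"
      using P_subset vimage_subset_H3[OF gen_in_G[OF F(1)] P_subset]
      by (intro interior_vimage_G WG) auto
    obtain j where j: "W j = gen F \<circ> W i"
      using holonomy_adjacent[OF s n F(1)] EF unfolding W_def E_def by blast
    have "W i -` (P \<union> gen F -` P) = W i -` P \<union> W j -` P" by (auto simp: j)
    then have "W i -` (P \<union> gen F -` P) \<subseteq> T" using tile_T[of i] tile_T[of j] by simp
    with yi int_mono show False by blast
  qed
  have "ball x e \<subseteq> closure T"
  proof (rule convex_subset_closure_codim2[OF convex_ball open_ball frontier_T])
    show "aff_dim (fst s) \<le> int DIM(real^3) - 2" using s edge_shape by (simp add: flag_def)
    have "x \<in> W 0 -` P"
      using x s face_subset(1)[of "snd s"] by (auto simp: W_def flag_def)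
    then have "ball x e \<inter> interior (W 0 -` P) \<noteq> {}"
      using e(1) by (intro tile_interior_meets_nhd[OF WG]) auto
    then show "ball x e \<inter> interior T \<noteq> {}" using interior_mono[OF tile_T[of 0]] by blast
  qed
  then have "ball x e \<subseteq> T" using closure_T by blast
  then have "x \<in> interior T" using e(1) mem_interior by metis
  moreover have "T = (\<Union>W\<in>holonomy s ` {..<n}. W -` P)" by (auto simp: T_def W_def)
  ultimately show ?thesis by (simp only:)
qed

text \<open>
  According to the position of \<open>x\<close> in \<open>P\<close> the tiles around it are \<open>P\<close> alone, two tiles, or the
  tiles of an edge cycle. In the last case \<open>g\<close> is a partial product along the iterated cycle that
  carries the edge to itself, and such a product consists of complete cycles.
\<close>

lemma stabilizer_of_generic_point:
  assumes x: "x \<in> P" and g: "g \<in> G" "g x = x" "g \<noteq> id"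
    and generic: "\<And>W. W \<in> G \<Longrightarrow> W x \<notin> endpoints"
  shows "g \<in> generators faces gen \<union> {r ^^ n | r n. r \<in> relators faces edges gen}"
proof (cases "x \<in> interior P")
  case True
  have "g \<in> {id}"
    by (rule tile_in_neighbouring_tiles[of _ x]) (use True x g in \<open>simp_all add: id_in_G\<close>)
  with g(3) show ?thesis by simp
next
  case False
  then obtain F where F: "F \<in> faces" "x \<in> F" using boundary_point_in_face[OF x] by blast
  show ?thesis
  proof (cases "x \<in> rel_interior F")
    case True
    have "g \<in> {id, gen F}"
      by (rule tile_in_neighbouring_tiles[of _ x])
        (use face_neighbourhood[OF F(1) True] x g gen_in_G[OF F(1)] in \<open>simp_all add: id_in_G\<close>)
    with g(3) F(1) show ?thesis by (auto simp: generators_def)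
  next
    case False
    then obtain E where E: "E \<in> edges" "E \<subseteq> F" "x \<in> E" using face_interior_iff[OF F] by auto
    define s where "s = (E, F)"
    define n where "n = (LEAST n. edge_returns faces gen E F n)"
    have s: "flag s" using E F by (simp add: s_def flag_def)
    have returns: "edge_returns faces gen E F n"
      unfolding n_def using edge_cycle_closes[OF E(1) F(1) E(2)] by (rule LeastI_ex)
    then have n: "n > 0" "(step ^^ n) s = s"
      using return_to_flag[OF s] by (auto simp: edge_returns_def s_def)
    have r: "edge_relator faces gen E F = holonomy s n"
      by (simp add: edge_relator_def edge_cycle_def holonomy_def n_def s_def)
    then have r_rel: "holonomy s n \<in> relators faces edges gen"
      using E F unfolding relators_def by (metis (mono_tags, lifting) mem_Collect_eq)
    have "\<exists>m>0. holonomy s n ^^ m = id"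
      using edge_cycle_relator[OF E(1) F(1) E(2)] unfolding r
      by (elim disjE conjE) (auto intro: exI[of _ "Suc 0"])
    then obtain m where m: "m > 0" "holonomy s n ^^ m = id" by blast
    \<comment> \<open>The product over one cycle may be a nontrivial rotation; only after \<open>m\<close> cycles is it the identity.\<close>
    have "x \<in> interior (\<Union>W\<in>holonomy s ` {..<n * m}. W -` P)"
      using n m holonomy_multiple[OF n(2)] E(3) generic
      by (intro edge_neighbourhood[OF s]) (auto simp: s_def)
    moreover have "holonomy s ` {..<n * m} \<subseteq> G" "x \<in> g -` P"
      using holonomy_in_G[OF s] x g(2) by auto
    ultimately have "g \<in> holonomy s ` {..<n * m}"
      using g(1) tile_in_neighbouring_tiles by meson
    then obtain i where i: "g = holonomy s i" by blast
    have flag_i: "flag ((step ^^ i) s)" by (rule flag_step_power[OF s])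
    have "x \<in> fst ((step ^^ i) s)"
      using holonomy_image[of s i] g(2) E(3) unfolding i[symmetric] by (force simp: s_def)
    then have "fst ((step ^^ i) s) = E"
      using unique_edge_at_point[of E "fst ((step ^^ i) s)" x] E flag_i generic[OF id_in_G]
      by (simp add: flag_def)
    then have "fst ((step ^^ (i mod n)) s) = E" by (simp add: funpow_mod_eq[OF n(2)])
    then have "i mod n = 0"
      using not_less_Least[of "i mod n" "edge_returns faces gen E F"] n(1)
      by (fastforce simp: edge_returns_def s_def n_def[symmetric])
    then have "g = holonomy s n ^^ (i div n)"
      using holonomy_multiple(1)[OF n(2), of "i div n"] i by (metis mult_div_mod_eq add.right_neutral)
    then show ?thesis using r_rel by blast
  qed
qed

end

section \<open>Fixed points in general position and elliptic elements\<close>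

context kleinian_polyhedron
begin

lemma countable_G: "countable G"
proof -
  have "countable (lists faces)"
    using locally_finite_countable[OF faces_locally_finite] by (rule countable_lists)
  moreover have "G \<subseteq> word_map gen ` lists faces"
  proof
    fix g assume "g \<in> G"
    then have "g \<in> generate isom_H3 (generators faces gen)" using pairings_generate by simp
    then show "g \<in> word_map gen ` lists faces"
    proof induction
      case one
      show ?case by (rule image_eqI[of _ _ "[]"]) (simp_all add: word_map_def isom_H3_simps)
    next
      case (incl h)
      then obtain F where "F \<in> faces" "h = gen F" by (auto simp: generators_def)
      then show ?case by (intro image_eqI[of _ _ "[F]"]) (simp_all add: word_map_def)
    next
      case (inv h)
      then obtain F where "F \<in> faces" "h = gen F" by (auto simp: generators_def)
      then show ?case
        using partner_face(1)[of F] pairing_inverse[of F]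
        by (intro image_eqI[of _ _ "[gen F ` F]"]) (simp_all add: word_map_def)
    next
      case (eng h1 h2)
      then obtain u v where uv: "u \<in> lists faces" "v \<in> lists faces"
        "h1 = word_map gen u" "h2 = word_map gen v" by auto
      have fold_comp: "fold (\<lambda>F f. gen F \<circ> f) w h = word_map gen w \<circ> h" for w h
        unfolding word_map_def by (induction w rule: rev_induct) (simp_all add: o_assoc)
      have "h1 \<otimes>\<^bsub>isom_H3\<^esub> h2 = word_map gen (v @ u)"
        using fold_comp[of u "word_map gen v"] uv by (simp add: isom_H3_simps word_map_def)
      then show ?case using uv by (intro image_eqI[of _ _ "v @ u"]) auto
    qed
  qed
  ultimately show ?thesis by (meson countable_image countable_subset)
qed

text \<open>
  The axis of \<open>g\<close> is uncountable, while the translates of \<open>endpoints\<close> are countably many points.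
\<close>

lemma generic_fixed_point:
  assumes "g \<in> G" "elliptic g"
  obtains x where "x \<in> H3" "g x = x" "\<And>W. W \<in> G \<Longrightarrow> W x \<notin> endpoints"
proof -
  obtain x0 where x0: "x0 \<in> H3" "g x0 = x0" using assms(2) by (auto simp: elliptic_def)
  obtain v where v: "v \<noteq> 0" "\<And>t. x0 + t *\<^sub>R v \<in> H3 \<Longrightarrow> g (x0 + t *\<^sub>R v) = x0 + t *\<^sub>R v"
    using isometry_fixes_line[OF G_isometry[OF assms(1)] x0] by blast
  define line where "line = (\<lambda>t. x0 + t *\<^sub>R v)"
  define bad where "bad = (\<Union>W\<in>G. W -` endpoints)"
  have "countable (W -` endpoints)" if "W \<in> G" for W
    using countable_image[OF countable_endpoints, of "inv_into UNIV W"]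
      bij_vimage_eq_inv_image[OF permutes_bij[OF G_permutes[OF that]]] by simp
  then have "countable bad" unfolding bad_def using countable_G by blast
  have inj: "inj line" using v(1) by (auto simp: line_def inj_on_def)
  have "open (line -` H3)"
    by (rule open_vimage) (auto simp: H3_def line_def intro!: continuous_intros)
  moreover have "0 \<in> line -` H3" using x0(1) by (simp add: line_def)
  ultimately obtain e where e: "e > 0" "ball 0 e \<subseteq> line -` H3" by (rule openE)
  have "uncountable (line ` ball 0 e)"
    using countable_image_inj_on[OF _ inj_on_subset[OF inj]] uncountable_ball[OF e(1), of 0] by blast
  then have "\<not> line ` ball 0 e \<subseteq> bad" using \<open>countable bad\<close> countable_subset by blast
  then obtain t where t: "t \<in> ball 0 e" "line t \<notin> bad" by blast
  then have "line t \<in> H3" using e(2) by blast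
  with t(2) v(2) show thesis by (intro that[of "line t"]) (auto simp: line_def bad_def)
qed

end

theorem mainTheorem2:
  fixes G :: "(real^3 \<Rightarrow> real^3) set"
    and P :: "(real^3) set"
    and faces edges :: "(real^3) set set"
    and gen :: "(real^3) set \<Rightarrow> real^3 \<Rightarrow> real^3"
    and g :: "real^3 \<Rightarrow> real^3"
  assumes "kleinian_group G"
    and "fundamental_polyhedron G P faces edges gen"
    and "g \<in> G"
    and "elliptic g"
  shows "let S = generators faces gen \<union> relators faces edges gen \<union>
                 {r ^^ n | r n. r \<in> relators faces edges gen}
         in g \<in> S \<or>
            (\<exists>h\<in>G. \<exists>s\<in>S. g = h \<otimes>\<^bsub>isom_H3\<^esub> s \<otimes>\<^bsub>isom_H3\<^esub> inv\<^bsub>isom_H3\<^esub> h)"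
proof -
  interpret kleinian_polyhedron G P faces edges gen
    using assms(1,2)
    by (simp add: kleinian_polyhedron_def kleinian_polyhedron_axioms_def kleinian_group_def)
  obtain x where x: "x \<in> H3" "g x = x" "\<And>W. W \<in> G \<Longrightarrow> W x \<notin> endpoints"
    using generic_fixed_point[OF assms(3,4)] by blast
  obtain h where h: "h \<in> G" "x \<in> h ` P" using x(1) translates_cover by blast
  define k where "k = inv_into UNIV h"
  have k: "k \<in> G" and kh: "k \<circ> h = id" and hk: "h \<circ> k = id"
    using inv_in_G[OF h(1)] G_inverse[OF h(1)] by (auto simp: k_def fun_eq_iff)
  define s where "s = k \<circ> g \<circ> h"
  have conj: "g = h \<circ> s \<circ> k"
    using hk by (simp add: s_def o_assoc) (simp add: hk comp_assoc)
  have "s \<in> generators faces gen \<union> {r ^^ n | r n. r \<in> relators faces edges gen}"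
  proof (rule stabilizer_of_generic_point[of "k x"])
    show "k x \<in> P" using h G_inverse(2)[OF h(1)] by (auto simp: k_def)
    show "s \<in> G" unfolding s_def by (intro comp_in_G k h(1) assms(3))
    show "s (k x) = k x" using x(2) hk by (simp add: s_def fun_eq_iff)
    show "s \<noteq> id" using assms(4) hk conj by (auto simp: elliptic_def)
    show "W (k x) \<notin> endpoints" if "W \<in> G" for W
      using x(3)[OF comp_in_G[OF that k]] by simp
  qed
  moreover have "g = h \<otimes>\<^bsub>isom_H3\<^esub> s \<otimes>\<^bsub>isom_H3\<^esub> inv\<^bsub>isom_H3\<^esub> h"
    using conj by (simp add: isom_H3_simps inv_isom[OF h(1)] k_def)
  ultimately show ?thesis unfolding Let_def using h(1) by blast
qed

end
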